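(* For each $d$ let $p_d$ be a monic polynomial of degree $d$ all of whose roots are nonnegative real numbers, with $\kappa_1^{(d)}(p_d)=1$. Let $\mu$ be a probability measure with compact support, and assume that $\mu\llbracket p_d\rrbracket$ converges weakly to $\mu$ as $d\to\infty$. Then for every $n\in\mathbb{N}$, $$\lim_{\substack{d,m\to\infty\\ m/d\to 0}}\kappa_n^{(d)}\Big(D_{1/m}\big((p_d^{\boxtimes_d m})^{\boxplus_d m}\big)\Big)=\frac{(\kappa_2(\mu)\,n)^{n-1}}{n!},$$ i.e. the limit coincides with the $n$-th free cumulant of $\eta_{\kappa_2(\mu)}$.
   Context: For a monic polynomial $p$ of degree $d$ write $p(x)=\sum_{i=0}^d(-1)^i\binom{d}{i}\widetilde a_i(p)x^{d-i}$, which defines $\widetilde a_i(p)$. If $p(x)=\prod_{k=1}^d(x-\lambda_k)$, its empirical root distribution is $\mu\llbracket p\rrbracket=\frac1d\sum_{k=1}^d\delta_{\lambda_k}$. For $c\ne0$, $D_c(p)(x)=c^dp(x/c)$. For monic $p,q$ of degree $d$: the finite free additive convolution is $(p\boxplus_d q)(x)=\sum_{k=0}^d(-1)^k\binom dk\sum_{i+j=k}\frac{k!}{i!j!}\widetilde a_i(p)\widetilde a_j(q)x^{d-k}$, and the finite free multiplicative convolution is $(p\boxtimes_d q)(x)=\sum_{i=0}^d(-1)^i\binom di\widetilde a_i(p)\widetilde a_i(q)x^{d-i}$. $p^{\boxplus_d m}$ and $p^{\boxtimes_d m}$ denote the $m$-fold convolution powers. The finite free cumulants are, for $1\le n\le d$,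 $\kappa_n^{(d)}(p)=\frac{(-d)^{n-1}}{(n-1)!}\sum_{\pi\in\mathcal{P}(n)}\widetilde a_\pi(p)\mu_n(\pi,1_n)$, where $\mathcal{P}(n)$ is the lattice of set partitions of $\{1,\dots,n\}$, $1_n$ is the one-block partition, $\mu_n$ is the Möbius function of $\mathcal{P}(n)$, $\widetilde a_\pi(p)=\prod_{V\in\pi}\widetilde a_{|V|}(p)$ (product over blocks), and $\mu_n(\pi,1_n)=(-1)^{|\pi|-1}(|\pi|-1)!$ with $|\pi|$ the number of blocks. In particular $\kappa_1^{(d)}(p)=\widetilde a_1(p)$. For fixed $n$ the quantity is considered for $d\ge n$. $\kappa_n(\rho)$ denotes the $n$-th free cumulant of a probability measure $\rho$; $\kappa_2(\mu)$ is the variance of $\mu$. For $\alpha\geq 0$, $\eta_\alpha$ is the probability measure on $[0,\infty)$ with free cumulants $\kappa_n(\eta_\alpha)=\frac{(\alpha n)^{n-1}}{n!}$, $n\in\mathbb{N}$. Convention: $0^0=1$. The limit means: along any $d,m\to\infty$ with $m/d\to0$.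
   Formalization: Besides weak convergence of the root distributions to μ, all their moments are assumed to converge to those of μ; without this the claim fails, e.g. one root √d and d−1 roots (d−√d)/(d−1) at n=2. *)

theory Defs
  imports "HOL-Probability.Probability" "HOL-Computational_Algebra.Computational_Algebra"
begin

section \<open>Finite free probability\<close>

text \<open>
  The degree \<open>d\<close> is an explicit argument throughout; the polynomials are meant to be monic of
  degree \<open>d\<close>. The number \<open>norm_coeff d p i\<close> is determined by
  \<open>p(x) = (\<Sum>i\<le>d. (-1)^i * (d choose i) * norm_coeff d p i * x^(d-i))\<close>; it is only meaningful
  for \<open>i \<le> d\<close>.
\<close>

definition norm_coeff :: "nat \<Rightarrow> real poly \<Rightarrow> nat \<Rightarrow> real" where
  "norm_coeff d p i = (-1) ^ i * coeff p (d - i) / real (d choose i)"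

definition fadd :: "nat \<Rightarrow> real poly \<Rightarrow> real poly \<Rightarrow> real poly" where
  "fadd d p q = (\<Sum>k\<le>d. monom ((-1) ^ k * real (d choose k) *
     (\<Sum>(i, j)\<in>{(i, j). i + j = k}.
        fact k / (fact i * fact j) * norm_coeff d p i * norm_coeff d q j)) (d - k))"

definition fmult :: "nat \<Rightarrow> real poly \<Rightarrow> real poly \<Rightarrow> real poly" where
  "fmult d p q = (\<Sum>i\<le>d. monom ((-1) ^ i * real (d choose i) *
     norm_coeff d p i * norm_coeff d q i) (d - i))"

text \<open>Convolution powers with \<open>m \<ge> 1\<close> factors \<open>p\<close>; the value at \<open>m = 0\<close> is irrelevant.\<close>

definition fadd_power :: "nat \<Rightarrow> nat \<Rightarrow> real poly \<Rightarrow> real poly" where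
  "fadd_power d m p = (fadd d p ^^ (m - 1)) p"

definition fmult_power :: "nat \<Rightarrow> nat \<Rightarrow> real poly \<Rightarrow> real poly" where
  "fmult_power d m p = (fmult d p ^^ (m - 1)) p"

text \<open>\<open>c^d * p(x / c)\<close>, for \<open>c \<noteq> 0\<close>\<close>

definition dilation :: "nat \<Rightarrow> real \<Rightarrow> real poly \<Rightarrow> real poly" where
  "dilation d c p = smult (c ^ d) (pcompose p [:0, 1 / c:])"

text \<open>
  The factor \<open>(-1)^(card \<pi> - 1) * (card \<pi> - 1)!\<close> is the value of the Moebius function of the
  lattice of set partitions of \<open>{1..n}\<close> on the interval from \<open>\<pi>\<close> to the one-block partition.
\<close>

definition finite_free_cumulant :: "nat \<Rightarrow> nat \<Rightarrow> real poly \<Rightarrow> real" where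
  "finite_free_cumulant d n p = (- real d) ^ (n - 1) / fact (n - 1) *
     (\<Sum>\<pi> | partition_on {1..n} \<pi>.
        (\<Prod>V\<in>\<pi>. norm_coeff d p (card V)) * ((-1) ^ (card \<pi> - 1) * fact (card \<pi> - 1)))"

text \<open>
  Roots are counted with multiplicity. Only real roots are seen, so this is the empirical root
  distribution of \<open>p\<close> if all complex roots of \<open>p\<close> are real (and \<open>degree p \<ge> 1\<close>).
\<close>

definition root_distribution :: "real poly \<Rightarrow> real measure" where
  "root_distribution p = distr (measure_pmf (pmf_of_multiset (proots p))) borel (\<lambda>x. x)"

section \<open>Measures on the real line and their free cumulants\<close>

definition measure_support :: "real measure \<Rightarrow> real set" where
  "measure_support M = {x. \<forall>U. open U \<longrightarrow> x \<in> U \<longrightarrow> emeasure M U > 0}"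

text \<open>
  Only meaningful if the moment is finite. The limit theorem assumes convergence of the moments of
  the root distributions in addition to weak convergence, because weak convergence does not control
  outlying roots: with \<open>s = sqrt d\<close>, one root \<open>s\<close> and \<open>d - 1\<close> roots \<open>(d - s) / (d - 1)\<close>, the mean
  is 1 and the root distributions tend weakly to the point mass at 1, of variance 0, but the second
  finite free cumulants tend to 1, and so does the limit in the theorem for \<open>n = 2\<close>.
\<close>

definition moment :: "real measure \<Rightarrow> nat \<Rightarrow> real" where
  "moment M k = (\<integral>x. x ^ k \<partial>M)"

definition noncrossing_partitions :: "nat \<Rightarrow> nat set set set" where
  "noncrossing_partitions n = {\<pi>. partition_on {1..n} \<pi> \<and>
     (\<forall>V\<in>\<pi>. \<forall>W\<in>\<pi>. V \<noteq> W \<longrightarrow>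
        \<not> (\<exists>a b c d. a < b \<and> b < c \<and> c < d \<and> a \<in> V \<and> c \<in> V \<and> b \<in> W \<and> d \<in> W))}"

lemma finite_noncrossing_partitions: "finite (noncrossing_partitions n)"
  by (rule finite_subset[of _ "{\<pi>. partition_on {1..n} \<pi>}"])
     (auto simp: noncrossing_partitions_def finitely_many_partition_on)

lemma card_block_less:
  assumes "\<pi> \<in> noncrossing_partitions n - {{{1..n}}}" "V \<in> \<pi>"
  shows "card V < n"
proof -
  have p: "\<Union>\<pi> = {1..n}" "disjoint \<pi>" "{} \<notin> \<pi>" and ne: "\<pi> \<noteq> {{1..n}}"
    using assms by (auto simp: noncrossing_partitions_def partition_on_def)
  have sub: "V \<subseteq> {1..n}" using p(1) assms(2) by blast
  have "V \<noteq> {1..n}"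
  proof
    assume V: "V = {1..n}"
    have "W = V" if W: "W \<in> \<pi>" for W
    proof (rule ccontr)
      assume "W \<noteq> V"
      then have "W \<inter> V = {}" using p(2) W assms(2) by (auto simp: disjoint_def)
      moreover have "W \<subseteq> V" using p(1) W V by blast
      ultimately have "W = {}" by blast
      then show False using p(3) W by simp
    qed
    then have "\<pi> = {{1..n}}" using assms(2) V by blast
    then show False using ne by simp
  qed
  then have "card V < card {1..n}" using sub by (intro psubset_card_mono) auto
  then show ?thesis by simp
qed

text \<open>
  The free cumulants are defined by solving the moment-cumulant formula
  (lemma \<open>moment_cumulant\<close> below) for the term of the one-block partition.
\<close>

function free_cumulant :: "real measure \<Rightarrow> nat \<Rightarrow> real" where
  "free_cumulant M n = moment M n -
     sum (\<lambda>\<pi>. prod (\<lambda>V. free_cumulant M (card V)) \<pi>) (noncrossing_partitions n - {{{1..n}}})"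
  by pat_completeness auto
termination
  by (relation "Wellfounded.measure snd") (simp_all add: card_block_less del: Diff_iff)

declare free_cumulant.simps [simp del]

lemma one_block_noncrossing: "n \<ge> 1 \<Longrightarrow> {{1..n}} \<in> noncrossing_partitions n"
  by (auto simp: noncrossing_partitions_def partition_on_def disjoint_def)

theorem moment_cumulant:
  assumes "n \<ge> 1"
  shows "moment M n = (\<Sum>\<pi>\<in>noncrossing_partitions n. \<Prod>V\<in>\<pi>. free_cumulant M (card V))"
  using sum.remove[OF finite_noncrossing_partitions one_block_noncrossing[OF assms],
      of "\<lambda>\<pi>. \<Prod>V\<in>\<pi>. free_cumulant M (card V)"]
  by (simp add: free_cumulant.simps[of M n])

lemma noncrossing_partitions_2: "noncrossing_partitions 2 - {{{1..2}}} = {{{1}, {2}}}"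
proof (intro equalityI subsetI)
  fix \<pi> assume \<pi>: "\<pi> \<in> noncrossing_partitions 2 - {{{1..2}}}"
  have un: "\<Union>\<pi> = {1..2}" and ne: "{} \<notin> \<pi>"
    using \<pi> by (auto simp: noncrossing_partitions_def partition_on_def)
  have single: "V = {1} \<or> V = {2}" if V: "V \<in> \<pi>" for V
  proof -
    have "V \<subseteq> {1..2}" using un V by blast
    moreover have "{1..2 :: nat} = {1, 2}" by auto
    ultimately have "V \<subseteq> {1, 2}" by simp
    moreover have "V \<noteq> {}" using ne V by auto
    moreover have "card V < 2" using card_block_less[OF \<pi> V] .
    then have "V \<noteq> {1, 2}" by auto
    ultimately show ?thesis by blast
  qed
  have "1 \<in> \<Union>\<pi>" "2 \<in> \<Union>\<pi>" unfolding un by simp_all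
  then obtain V W where VW: "V \<in> \<pi>" "1 \<in> V" "W \<in> \<pi>" "2 \<in> W" by blast
  have "V = {1}" using single[OF VW(1)] VW(2) by auto
  moreover have "W = {2}" using single[OF VW(3)] VW(4) by auto
  ultimately have "{1} \<in> \<pi>" "{2} \<in> \<pi>" using VW by simp_all
  then have "\<pi> = {{1}, {2}}" using single by blast
  then show "\<pi> \<in> {{{1}, {2}}}" by simp
next
  fix \<pi> :: "nat set set" assume "\<pi> \<in> {{{1}, {2}}}"
  then have \<pi>: "\<pi> = {{1}, {2}}" by simp
  have "partition_on {1..2} {{1}, {2 :: nat}}"
  proof -
    have "{1..2 :: nat} = {1} \<union> {2}" by auto
    then show ?thesis unfolding partition_on_def disjoint_def by simp
  qed
  moreover have "{{1}, {2}} \<noteq> {{1..2 :: nat}}"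
  proof
    assume "{{1}, {2}} = {{1..2 :: nat}}"
    then have "{1} = {1..2 :: nat}" by blast
    then have "2 \<in> {1 :: nat}" by simp
    then show False by simp
  qed
  ultimately show "\<pi> \<in> noncrossing_partitions 2 - {{{1..2}}}"
    unfolding \<pi> noncrossing_partitions_def by simp
qed

lemma noncrossing_partitions_1: "noncrossing_partitions 1 - {{{1..1}}} = {}"
proof -
  have False if \<pi>: "\<pi> \<in> noncrossing_partitions 1 - {{{1..1}}}" for \<pi>
  proof -
    have un: "\<Union>\<pi> = {1..1}" and ne: "{} \<notin> \<pi>"
      using \<pi> by (auto simp: noncrossing_partitions_def partition_on_def)
    have "1 \<in> \<Union>\<pi>" using un by simp
    then obtain V where V: "V \<in> \<pi>" "1 \<in> V" by blast
    have "finite V" using un V by (metis Sup_upper finite_atLeastAtMost finite_subset)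
    then have "card V > 0" using V by (auto simp: card_gt_0_iff)
    then show False using card_block_less[OF \<pi> V(1)] by simp
  qed
  then show ?thesis by blast
qed

lemma free_cumulant_1: "free_cumulant M 1 = moment M 1"
  using free_cumulant.simps[of M 1] unfolding noncrossing_partitions_1 by simp

lemma free_cumulant_2: "free_cumulant M 2 = moment M 2 - (moment M 1)\<^sup>2"
  using free_cumulant.simps[of M 2] free_cumulant_1[of M] unfolding noncrossing_partitions_2
  by (simp add: power2_eq_square)

lemma (in real_distribution) free_cumulant_2_eq_variance:
  assumes "integrable M (\<lambda>x. x)" "integrable M (\<lambda>x. x\<^sup>2)"
  shows "free_cumulant M 2 = variance (\<lambda>x. x)"
  using assms by (simp add: free_cumulant_2 moment_def variance_eq)

text \<open>
  The measure \<open>\<eta>\<^sub>\<alpha>\<close>, for \<open>\<alpha> \<ge> 0\<close>, is the probability measure on \<open>[0, \<infinity>)\<close> with these free cumulants.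
  Note \<open>0^0 = 1\<close>.
\<close>

definition is_eta :: "real \<Rightarrow> real measure \<Rightarrow> bool" where
  "is_eta \<alpha> \<eta> \<longleftrightarrow> real_distribution \<eta> \<and> (AE x in \<eta>. 0 \<le> x) \<and>
     (\<forall>k. integrable \<eta> (\<lambda>x. x ^ k)) \<and>
     (\<forall>n\<ge>1. free_cumulant \<eta> n = (\<alpha> * real n) ^ (n - 1) / fact n)"

end

theory Submission
  imports Defs
begin

text \<open>
  Let \<open>a\<^sub>i\<close> be the normalised coefficients of a monic polynomial of degree \<open>d\<close> and
  \<open>f(x) = \<Sum> a\<^sub>i x^i / i!\<close>. The Moebius sum over set partitions computes the coefficients of
  \<open>log f\<close>, so \<open>\<kappa>\<^sub>n = (-d)^(n-1) [x^(n-1)] f'/f\<close>. Additive convolution multiplies the series \<open>f\<close>,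
  multiplicative convolution multiplies the numbers \<open>a\<^sub>i\<close>. Hence, for \<open>b\<^sub>i = a\<^sub>i^m\<close>,
  \<open>f(x) = \<Sum> b\<^sub>i x^i / i!\<close> and \<open>\<epsilon> = -m/d\<close>, the cumulant in question is the coefficient of
  \<open>z^(n-1)\<close> in \<open>\<Psi> = f'/f\<close>, written in the variable \<open>z = \<epsilon> x\<close>
  (lemma \<open>finite_free_cumulant_convolution_powers\<close>).

  The coefficients of \<open>\<Psi>\<close> are controlled by the ratios \<open>r\<^sub>i = b\<^sub>i\<^sub>+\<^sub>1 / b\<^sub>i\<close>. Inserting Newton's
  interpolation formula for \<open>r\<close> into \<open>b\<^sub>i\<^sub>+\<^sub>1 = r\<^sub>i b\<^sub>i\<close> gives
  \<open>f' = \<Sum>\<^sub>k (\<Delta>^k r(0) / k!) x^k f^(k)\<close>. If \<open>r\<^sub>i\<close> varies so slowly that it looks like \<open>W(\<epsilon> i)\<close>, in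
  the sense that \<open>\<Delta>^k r(0) / \<epsilon>^k\<close> tends to \<open>k! W\<^sub>k\<close>, then division by \<open>f\<close> and \<open>\<epsilon> \<rightarrow> 0\<close> turn
  \<open>z^k f^(k) / f\<close> into \<open>(z \<Psi>)^k\<close>, up to terms that vanish with \<open>\<epsilon>\<close>. The limit \<open>U\<close> of \<open>\<Psi>\<close> is
  therefore the power series with \<open>U = W(z U)\<close>. The system of equations for the coefficients is
  triangular, so the limits of the differences determine those of \<open>\<Psi>\<close>
  (lemma \<open>log_deriv_limit_from_symbol\<close>) and conversely (lemma \<open>symbol_from_log_deriv_limit\<close>).
  The series \<open>W\<close> is called the symbol of \<open>r\<close>. Symbols are multiplicative.

  This correspondence is used in both directions. For the polynomial \<open>p\<^sub>d\<close> itself, with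
  \<open>\<epsilon> = -1/d\<close>, the coefficients weighted by falling factorials have the generating function
  \<open>\<Prod> (1 - \<lambda> z)\<close> over the roots \<open>\<lambda>\<close>, so that the coefficients of \<open>\<Psi>\<close> are the moments of the
  root distribution, which converge. Thus \<open>a\<^sub>i\<^sub>+\<^sub>1 / a\<^sub>i\<close> has a symbol, and it is
  \<open>1 + \<sigma> s + \<dots>\<close>, where \<open>\<sigma>\<close> is the variance of the limit. The \<open>m\<close>-th power of the ratios, on
  the scale \<open>m \<epsilon>\<close>, only feels the linear term: its symbol is \<open>exp(\<sigma> s)\<close>
  (lemma \<open>has_symbol_large_power\<close>), the limit \<open>(1 + \<sigma> s / m)^m \<rightarrow> exp(\<sigma> s)\<close> in disguise. So the
  limiting cumulants are the coefficients of the solution of \<open>U = exp(\<sigma> z U)\<close>, by Abel's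
  identity the numbers \<open>(\<sigma> n)^(n-1) / n!\<close> familiar from counting rooted trees (lemma
  \<open>tree_series_exp_equation\<close>).
\<close>

unbundle no vec_syntax

section \<open>Cumulants as coefficients of a logarithmic derivative\<close>

lemma sum_over_subsets_card:
  fixes h :: "nat \<Rightarrow> real"
  assumes "finite A"
  shows "(\<Sum>V\<in>Pow A. h (card V)) = (\<Sum>k\<le>card A. real (card A choose k) * h k)"
proof -
  have "(\<Sum>V\<in>Pow A. h (card V)) = (\<Sum>k\<le>card A. \<Sum>V | V \<in> Pow A \<and> card V = k. h (card V))"
    using assms by (intro sum.group[symmetric]) (auto intro: card_mono)
  also have "\<dots> = (\<Sum>k\<le>card A. real (card {V. V \<subseteq> A \<and> card V = k}) * h k)"
    by (intro sum.cong) (auto simp: Pow_def)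
  finally show ?thesis
    by (simp add: n_subsets[OF assms])
qed

text \<open>
  Removing a marked block from a partition. A weight of the form \<open>k!\<close> on partitions with \<open>k\<close>
  blocks is \<open>(k-1)!\<close> summed over all choices of a block, and a weight \<open>(k-1)!\<close> is recovered by
  marking the block of a fixed element; so both Moebius-type sums below reduce to this bijection.
\<close>

lemma sum_partition_block:
  fixes G :: "'a set \<Rightarrow> 'a set set \<Rightarrow> real"
  assumes "finite A"
  shows "(\<Sum>\<pi> | partition_on A \<pi>. \<Sum>V\<in>\<pi>. G V (\<pi> - {V})) =
    (\<Sum>V\<in>Pow A - {{}}. \<Sum>\<pi> | partition_on (A - V) \<pi>. G V \<pi>)"
proof -
  have fin: "finite \<pi>" if "partition_on A \<pi>" for \<pi>
    using that assms finite_elements by blast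
  have remove: "partition_on (A - V) (\<pi> - {V}) \<and> V \<subseteq> A \<and> V \<noteq> {}" if "partition_on A \<pi>" "V \<in> \<pi>" for \<pi> V
    using that partition_on_insert[of V "\<pi> - {V}" A]
    by (auto simp: insert_absorb partition_on_def disjnt_def disjoint_def)
  have join: "partition_on A (insert V \<pi>)" if "partition_on (A - V) \<pi>" "V \<subseteq> A" "V \<noteq> {}" for \<pi> V
  proof (subst partition_on_insert)
    show "disjnt V (\<Union>\<pi>)" using that by (auto simp: partition_on_def disjnt_def)
  qed (use that in auto)
  have fresh: "V \<notin> \<pi>" if "partition_on (A - V) \<pi>" "V \<noteq> {}" for \<pi> V
    using that by (auto simp: partition_on_def)
  have "(\<Sum>\<pi> | partition_on A \<pi>. \<Sum>V\<in>\<pi>. G V (\<pi> - {V})) =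
      (\<Sum>(\<pi>, V)\<in>(SIGMA \<pi>:{\<pi>. partition_on A \<pi>}. \<pi>). G V (\<pi> - {V}))"
    using finitely_many_partition_on[OF assms] fin by (intro sum.Sigma) auto
  also have "\<dots> = (\<Sum>(V, \<pi>)\<in>(SIGMA V:Pow A - {{}}. {\<pi>. partition_on (A - V) \<pi>}). G V \<pi>)"
    using remove fresh join
    by (intro sum.reindex_bij_witness[of _ "\<lambda>(V, \<pi>). (insert V \<pi>, V)" "\<lambda>(\<pi>, V). (V, \<pi> - {V})"])
       (auto simp: insert_absorb intro!: join)
  also have "\<dots> = (\<Sum>V\<in>Pow A - {{}}. \<Sum>\<pi> | partition_on (A - V) \<pi>. G V \<pi>)"
    using assms by (intro sum.Sigma[symmetric]) (auto intro: finitely_many_partition_on)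
  finally show ?thesis .
qed

text \<open>
  The sum obeys the recursion \<open>s(A) = - \<Sum> a(|V|) s(A - V)\<close> over the nonempty subsets \<open>V\<close> of
  \<open>A\<close>, which is the recursion for the coefficients of \<open>1/F\<close>.
\<close>

lemma partition_sum_inverse:
  fixes F :: "real fps" and a :: "nat \<Rightarrow> real"
  assumes "finite A" and F0: "F $ 0 = 1" and F: "\<And>i. i \<le> card A \<Longrightarrow> a i = fact i * F $ i"
  shows "(\<Sum>\<pi> | partition_on A \<pi>. (\<Prod>V\<in>\<pi>. a (card V)) * ((-1) ^ card \<pi> * fact (card \<pi>))) =
    fact (card A) * inverse F $ card A"
  using assms(1,3)
proof (induction A rule: finite_psubset_induct)
  case (psubset A)
  define s :: "'a set set \<Rightarrow> real"
    where "s \<pi> = (\<Prod>V\<in>\<pi>. a (card V)) * ((-1) ^ card \<pi> * fact (card \<pi>))" for \<pi>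
  let ?n = "card A"
  show ?case
  proof (cases "A = {}")
    case True
    then show ?thesis by (simp add: partition_on_empty F0)
  next
    case False
    have fin: "finite \<pi>" if "partition_on A \<pi>" for \<pi>
      using that psubset.hyps finite_elements by blast
    have "s \<pi> = (\<Sum>V\<in>\<pi>. - a (card V) * s (\<pi> - {V}))" if \<pi>: "partition_on A \<pi>" for \<pi>
    proof -
      have "\<pi> \<noteq> {}" using False \<pi> by (auto simp: partition_on_def)
      then obtain c where c: "card \<pi> = Suc c"
        using fin[OF \<pi>] by (metis card_eq_0_iff not0_implies_Suc)
      have "- a (card V) * s (\<pi> - {V}) = (\<Prod>V\<in>\<pi>. a (card V)) * ((-1) ^ Suc c * fact c)"
        if "V \<in> \<pi>" for V
        using that fin[OF \<pi>] c prod.remove[of \<pi> V "\<lambda>V. a (card V)"] by (simp add: s_def)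
      then have "(\<Sum>V\<in>\<pi>. - a (card V) * s (\<pi> - {V})) =
          (\<Sum>V\<in>\<pi>. (\<Prod>V\<in>\<pi>. a (card V)) * ((-1) ^ Suc c * fact c))"
        by (intro sum.cong) auto
      then show ?thesis
        using c by (simp add: s_def algebra_simps)
    qed
    then have "(\<Sum>\<pi> | partition_on A \<pi>. s \<pi>) =
        (\<Sum>\<pi> | partition_on A \<pi>. \<Sum>V\<in>\<pi>. - a (card V) * s (\<pi> - {V}))"
      by (intro sum.cong) auto
    also have "\<dots> = (\<Sum>V\<in>Pow A - {{}}. \<Sum>\<pi> | partition_on (A - V) \<pi>. - a (card V) * s \<pi>)"
      using psubset.hyps by (rule sum_partition_block)
    also have "\<dots> = (\<Sum>V\<in>Pow A - {{}}. - (fact (card V) * F $ card V *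
        (fact (?n - card V) * inverse F $ (?n - card V))))"
    proof (intro sum.cong refl)
      fix V assume V: "V \<in> Pow A - {{}}"
      then have fV: "finite V" and sub: "A - V \<subset> A" and le: "card V \<le> ?n"
        using psubset.hyps by (auto intro: finite_subset card_mono)
      have card: "card (A - V) = ?n - card V"
        using V fV by (simp add: card_Diff_subset)
      have "(\<Sum>\<pi> | partition_on (A - V) \<pi>. s \<pi>) = fact (?n - card V) * inverse F $ (?n - card V)"
        using psubset.IH[OF sub] psubset.prems by (simp add: s_def card)
      then show "(\<Sum>\<pi> | partition_on (A - V) \<pi>. - a (card V) * s \<pi>) =
          - (fact (card V) * F $ card V * (fact (?n - card V) * inverse F $ (?n - card V)))"
        using psubset.prems[OF le] by (simp add: sum_distrib_left[symmetric] sum_negf)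
    qed
    also have "\<dots> = fact ?n * inverse F $ ?n - (\<Sum>V\<in>Pow A. fact (card V) * F $ card V *
        (fact (?n - card V) * inverse F $ (?n - card V)))"
      using psubset.hyps sum.remove[of "Pow A" "{}" "\<lambda>V. fact (card V) * F $ card V *
        (fact (?n - card V) * inverse F $ (?n - card V))"]
      by (simp add: sum_negf F0)
    also have "(\<Sum>V\<in>Pow A. fact (card V) * F $ card V *
        (fact (?n - card V) * inverse F $ (?n - card V))) =
        (\<Sum>k\<le>?n. fact ?n * (F $ k * inverse F $ (?n - k)))"
      unfolding sum_over_subsets_card[OF psubset.hyps, of "\<lambda>k. fact k * F $ k * (fact (?n - k) * inverse F $ (?n - k))"]
      by (intro sum.cong) (auto simp: binomial_fact)
    also have "\<dots> = fact ?n * (F * inverse F) $ ?n"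
      by (simp add: fps_mult_nth sum_distrib_left atLeast0AtMost)
    also have "F * inverse F = 1"
      using F0 inverse_mult_eq_1[of F] by (simp add: mult.commute)
    finally show ?thesis
      using False psubset.hyps by (simp add: s_def)
  qed
qed

text \<open>
  Removing the block of the largest element leaves the partition sums of \<open>1/F\<close>, while that block
  contributes a coefficient of \<open>F'\<close>. Since \<open>F\<close> is only required to have the right coefficients up
  to the order that matters, one need not truncate products of generating functions at degree
  \<open>d\<close>.
\<close>

lemma finite_free_cumulant_log_deriv:
  fixes F :: "real fps"
  assumes F0: "F $ 0 = 1" and F: "\<And>i. i \<le> Suc n \<Longrightarrow> norm_coeff d p i = fact i * F $ i"
  shows "finite_free_cumulant d (Suc n) p = (- real d) ^ n * (fps_deriv F * inverse F) $ n"
proof -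
  define A where "A = {1..Suc n}"
  let ?a = "norm_coeff d p"
  have A: "finite A" "card A = Suc n" "Suc n \<in> A" by (auto simp: A_def)
  define s :: "nat set set \<Rightarrow> real"
    where "s \<pi> = (\<Prod>V\<in>\<pi>. ?a (card V)) * ((-1) ^ card \<pi> * fact (card \<pi>))" for \<pi>
  define G where "G V \<pi> = (if Suc n \<in> V then ?a (card V) * s \<pi> else 0)" for V \<pi>
  define h where "h k = fact (Suc k) * F $ Suc k * (fact (n - k) * inverse F $ (n - k))" for k
  have "(\<Prod>V\<in>\<pi>. ?a (card V)) * ((-1) ^ (card \<pi> - 1) * fact (card \<pi> - 1)) = (\<Sum>V\<in>\<pi>. G V (\<pi> - {V}))"
    if \<pi>: "partition_on A \<pi>" for \<pi>
  proof -
    have fin: "finite \<pi>" using \<pi> A finite_elements by blast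
    obtain V where V: "V \<in> \<pi>" "Suc n \<in> V" using \<pi> A by (auto simp: partition_on_def)
    have "Suc n \<notin> W" if "W \<in> \<pi> - {V}" for W
      using that V partition_onD2[OF \<pi>] by (auto simp: disjoint_def)
    then have "(\<Sum>W\<in>\<pi>. G W (\<pi> - {W})) = G V (\<pi> - {V})"
      using fin V by (subst sum.remove[of _ V]) (auto simp: G_def)
    also have "\<dots> = (\<Prod>V\<in>\<pi>. ?a (card V)) * ((-1) ^ (card \<pi> - 1) * fact (card \<pi> - 1))"
      using V fin prod.remove[of \<pi> V "\<lambda>V. ?a (card V)"] by (simp add: G_def s_def)
    finally show ?thesis by simp
  qed
  then have "(\<Sum>\<pi> | partition_on A \<pi>. (\<Prod>V\<in>\<pi>. ?a (card V)) * ((-1) ^ (card \<pi> - 1) * fact (card \<pi> - 1))) =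
      (\<Sum>\<pi> | partition_on A \<pi>. \<Sum>V\<in>\<pi>. G V (\<pi> - {V}))"
    by (intro sum.cong) auto
  also have "\<dots> = (\<Sum>V\<in>Pow A - {{}}. \<Sum>\<pi> | partition_on (A - V) \<pi>. G V \<pi>)"
    using A(1) by (rule sum_partition_block)
  also have "\<dots> = (\<Sum>V\<in>insert (Suc n) ` Pow {1..n}. \<Sum>\<pi> | partition_on (A - V) \<pi>. G V \<pi>)"
  proof (rule sum.mono_neutral_right)
    show "finite (Pow A - {{}})" using A by simp
    show "insert (Suc n) ` Pow {1..n} \<subseteq> Pow A - {{}}" by (auto simp: A_def)
    have "Suc n \<notin> V" if V: "V \<in> Pow A - {{}} - insert (Suc n) ` Pow {1..n}" for V
    proof
      assume "Suc n \<in> V"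
      then have "V = insert (Suc n) (V - {Suc n})" by auto
      moreover have "V - {Suc n} \<in> Pow {1..n}" using V by (auto simp: A_def)
      ultimately show False using V by blast
    qed
    then show "\<forall>V\<in>Pow A - {{}} - insert (Suc n) ` Pow {1..n}. (\<Sum>\<pi> | partition_on (A - V) \<pi>. G V \<pi>) = 0"
      by (simp add: G_def)
  qed
  also have "\<dots> = (\<Sum>V\<in>Pow {1..n}. \<Sum>\<pi> | partition_on (A - insert (Suc n) V) \<pi>. G (insert (Suc n) V) \<pi>)"
  proof (rule sum.reindex_cong[OF _ refl refl])
    show "inj_on (insert (Suc n)) (Pow {1..n})"
      by (rule inj_onI) (metis PowD Suc_n_not_le_n atLeastAtMost_iff insert_ident subsetD)
  qed
  also have "\<dots> = (\<Sum>V\<in>Pow {1..n}. h (card V))"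
  proof (intro sum.cong refl)
    fix V assume V: "V \<in> Pow {1..n}"
    then have fV: "finite V" by (auto intro: finite_subset)
    have le: "card V \<le> n" using V card_mono[of "{1..n}" V] by simp
    have notin: "Suc n \<notin> V" using V by auto
    have card: "card (A - insert (Suc n) V) = n - card V"
      using V fV A notin by (subst card_Diff_subset) (auto simp: A_def)
    have "(\<Sum>\<pi> | partition_on (A - insert (Suc n) V) \<pi>. s \<pi>) =
        fact (n - card V) * inverse F $ (n - card V)"
      using partition_sum_inverse[of "A - insert (Suc n) V" F ?a] A F0 F by (simp add: s_def card)
    then show "(\<Sum>\<pi> | partition_on (A - insert (Suc n) V) \<pi>. G (insert (Suc n) V) \<pi>) =
        h (card V)"
      using F[of "Suc (card V)"] le fV notin by (simp add: G_def h_def sum_distrib_left[symmetric])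
  qed
  also have "\<dots> = (\<Sum>k\<le>n. fact n * (fps_deriv F $ k * inverse F $ (n - k)))"
  proof -
    have *: "real (n choose k) * h k = fact n * (fps_deriv F $ k * inverse F $ (n - k))" if "k \<le> n" for k
      using that by (simp add: h_def binomial_fact field_simps)
    show ?thesis
      using sum_over_subsets_card[of "{1..n}" h] * by (simp del: fps_deriv_nth)
  qed
  also have "\<dots> = fact n * (fps_deriv F * inverse F) $ n"
    by (simp add: fps_mult_nth sum_distrib_left atLeast0AtMost)
  finally show ?thesis
    by (simp add: finite_free_cumulant_def A_def)
qed

lemma norm_coeff_0:
  assumes "degree p = d" "lead_coeff p = 1"
  shows "norm_coeff d p 0 = 1"
  unfolding assms(1)[symmetric] norm_coeff_def using assms(2) by simp

lemma finite_free_cumulant_1: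
  assumes "norm_coeff d p 0 = 1"
  shows "finite_free_cumulant d 1 p = norm_coeff d p 1"
proof -
  define F where "F = Abs_fps (\<lambda>i. norm_coeff d p i / fact i)"
  have "finite_free_cumulant d (Suc 0) p = (- real d) ^ 0 * (fps_deriv F * inverse F) $ 0"
    by (rule finite_free_cumulant_log_deriv) (simp_all add: F_def assms)
  then show ?thesis by (simp add: F_def assms)
qed

section \<open>Convolution powers\<close>

lemma coeff_sum_monom_reversed:
  fixes f :: "nat \<Rightarrow> real"
  assumes "k \<le> d"
  shows "coeff (\<Sum>i\<le>d. monom (f i) (d - i)) (d - k) = f k"
proof -
  have "coeff (\<Sum>i\<le>d. monom (f i) (d - i)) (d - k) = (\<Sum>i\<le>d. if i = k then f i else 0)"
    unfolding coeff_sum coeff_monom using assms by (intro sum.cong) auto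
  then show ?thesis using assms by simp
qed

lemma norm_coeff_of_sum:
  assumes "k \<le> d"
  shows "norm_coeff d (\<Sum>i\<le>d. monom ((-1) ^ i * (real (d choose i) * f i)) (d - i)) k = f k"
  unfolding norm_coeff_def coeff_sum_monom_reversed[OF assms] using assms
  by (simp add: mult.assoc[symmetric] power_mult_distrib[symmetric])

lemma norm_coeff_fmult:
  "i \<le> d \<Longrightarrow> norm_coeff d (fmult d p q) i = norm_coeff d p i * norm_coeff d q i"
  unfolding fmult_def mult.assoc by (rule norm_coeff_of_sum)

lemma norm_coeff_fmult_power:
  assumes "i \<le> d" "m \<ge> 1"
  shows "norm_coeff d (fmult_power d m p) i = norm_coeff d p i ^ m"
proof -
  have "norm_coeff d ((fmult d p ^^ l) p) i = norm_coeff d p i ^ Suc l" for l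
    using assms(1) by (induction l) (simp_all add: norm_coeff_fmult)
  from this[of "m - 1"] show ?thesis using assms(2) by (simp add: fmult_power_def)
qed

lemma norm_coeff_fadd:
  assumes k: "k \<le> d" and F: "\<And>i. i \<le> d \<Longrightarrow> norm_coeff d p i = fact i * F $ i"
    and G: "\<And>i. i \<le> d \<Longrightarrow> norm_coeff d q i = fact i * G $ i"
  shows "norm_coeff d (fadd d p q) k = fact k * (F * G) $ k"
proof -
  have "norm_coeff d (fadd d p q) k =
      (\<Sum>(i, j)\<in>{(i, j). i + j = k}. fact k / (fact i * fact j) * norm_coeff d p i * norm_coeff d q j)"
    unfolding fadd_def mult.assoc by (rule norm_coeff_of_sum[OF k])
  also have "{(i, j). i + j = k} = (\<lambda>i. (i, k - i)) ` {0..k}"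
    by force
  also have "(\<Sum>(i, j)\<in>\<dots>. fact k / (fact i * fact j) * norm_coeff d p i * norm_coeff d q j) =
      (\<Sum>i=0..k. fact k / (fact i * fact (k - i)) * norm_coeff d p i * norm_coeff d q (k - i))"
    by (subst sum.reindex) (auto simp: inj_on_def)
  also have "\<dots> = (\<Sum>i=0..k. fact k * (F $ i * G $ (k - i)))"
    using k by (intro sum.cong) (auto simp: F G)
  finally show ?thesis by (simp add: fps_mult_nth sum_distrib_left)
qed

lemma norm_coeff_fadd_power:
  assumes "k \<le> d" "m \<ge> 1" and F: "\<And>i. i \<le> d \<Longrightarrow> norm_coeff d p i = fact i * F $ i"
  shows "norm_coeff d (fadd_power d m p) k = fact k * (F ^ m) $ k"
proof -
  have "i \<le> d \<Longrightarrow> norm_coeff d ((fadd d p ^^ l) p) i = fact i * (F ^ Suc l) $ i" for l i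
    by (induction l arbitrary: i) (simp_all add: F norm_coeff_fadd[OF _ F])
  from this[of k "m - 1"] show ?thesis using assms(1,2) by (simp add: fadd_power_def)
qed

lemma norm_coeff_dilation:
  assumes "i \<le> d" "c \<noteq> 0"
  shows "norm_coeff d (dilation d c p) i = c ^ i * norm_coeff d p i"
proof -
  have "c ^ d * (1 / c) ^ (d - i) = c ^ i"
    using assms by (simp add: power_one_over power_diff field_simps)
  then show ?thesis
    by (simp add: norm_coeff_def dilation_def coeff_pcompose_linear mult.assoc[symmetric])
qed

text \<open>
  The exponential generating function \<open>\<Sum> b\<^sub>i x^i / i!\<close> in the variable \<open>z = e x\<close>.
\<close>

definition scaled_egf :: "real \<Rightarrow> (nat \<Rightarrow> real) \<Rightarrow> real fps" where
  "scaled_egf e b = Abs_fps (\<lambda>i. b i / (fact i * e ^ i))"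

text \<open>
  The logarithmic derivative with respect to \<open>x\<close>, not \<open>z\<close>, hence the factor \<open>e\<close>.
\<close>

definition scaled_log_deriv :: "real \<Rightarrow> (nat \<Rightarrow> real) \<Rightarrow> real fps" where
  "scaled_log_deriv e b = fps_const e * fps_deriv (scaled_egf e b) * inverse (scaled_egf e b)"

lemma scaled_egf_rescale:
  "scaled_egf (c * e) b = scaled_egf e b oo (fps_const (1 / c) * fps_X)"
  by (rule fps_ext) (simp add: scaled_egf_def power_mult_distrib power_divide)

lemma scaled_log_deriv_rescale:
  assumes b0: "b 0 = 1" and c: "c \<noteq> 0"
  shows "scaled_log_deriv (c * e) b $ n = scaled_log_deriv e b $ n / c ^ n"
proof -
  let ?B = "scaled_egf e b" and ?g = "fps_const (1 / c) * fps_X"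
  have "?B $ 0 \<noteq> 0" using b0 by (simp add: scaled_egf_def)
  then have inv: "inverse (?B oo ?g) = inverse ?B oo ?g"
    by (simp add: fps_inverse_compose)
  have "scaled_log_deriv (c * e) b = fps_const (c * e) * fps_deriv (?B oo ?g) * inverse (?B oo ?g)"
    by (simp add: scaled_log_deriv_def scaled_egf_rescale)
  also have "fps_deriv (?B oo ?g) = (fps_deriv ?B oo ?g) * fps_const (1 / c)"
    by (subst fps_compose_deriv) simp_all
  also have "fps_const (c * e) * ((fps_deriv ?B oo ?g) * fps_const (1 / c)) * inverse (?B oo ?g) =
      (fps_const (c * e) * fps_const (1 / c)) * ((fps_deriv ?B oo ?g) * (inverse ?B oo ?g))"
    unfolding inv by (simp only: mult_ac)
  also have "fps_const (c * e) * fps_const (1 / c) = fps_const e"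
    using c by simp
  also have "(fps_deriv ?B oo ?g) * (inverse ?B oo ?g) = (fps_deriv ?B * inverse ?B) oo ?g"
    by (simp add: fps_compose_mult_distrib)
  finally show ?thesis
    by (simp add: scaled_log_deriv_def power_divide mult.assoc)
qed

text \<open>
  The additive power raises the generating function \<open>H\<close> of \<open>a\<^sub>i^m\<close> to the power \<open>m\<close>, so it
  multiplies the logarithmic derivative by \<open>m\<close>; the dilation rescales the variable by \<open>1/m\<close>, and
  the factor \<open>(-d)^n\<close> in the cumulant rescales it by \<open>-d\<close>.
\<close>

lemma finite_free_cumulant_convolution_powers:
  assumes a0: "norm_coeff d p 0 = 1" and m: "m \<ge> 1" and n: "Suc n \<le> d"
  shows "finite_free_cumulant d (Suc n) (dilation d (1 / real m) (fadd_power d m (fmult_power d m p))) =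
    scaled_log_deriv (- real m / real d) (\<lambda>i. norm_coeff d p i ^ m) $ n"
proof -
  let ?b = "\<lambda>i. norm_coeff d p i ^ m"
  define E where "E = scaled_egf 1 ?b"
  define H where "H = scaled_egf (real m) ?b"
  have H: "H = E oo (fps_const (1 / real m) * fps_X)"
    unfolding H_def E_def using scaled_egf_rescale[of "real m" 1] by simp
  have Hm: "(H ^ m) $ i = (1 / real m) ^ i * (E ^ m) $ i" for i
    unfolding H by (subst fps_compose_power) simp_all
  have E: "norm_coeff d (fadd_power d m (fmult_power d m p)) i = fact i * (E ^ m) $ i" if "i \<le> d" for i
    using that m by (intro norm_coeff_fadd_power) (simp_all add: norm_coeff_fmult_power E_def scaled_egf_def)
  have H0: "H $ 0 = 1" using a0 by (simp add: H_def scaled_egf_def)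
  have "finite_free_cumulant d (Suc n) (dilation d (1 / real m) (fadd_power d m (fmult_power d m p))) =
      (- real d) ^ n * (fps_deriv (H ^ m) * inverse (H ^ m)) $ n"
  proof (rule finite_free_cumulant_log_deriv)
    show "(H ^ m) $ 0 = 1" by (simp add: fps_power_zeroth H0)
    show "norm_coeff d (dilation d (1 / real m) (fadd_power d m (fmult_power d m p))) i = fact i * (H ^ m) $ i"
      if "i \<le> Suc n" for i
      using that n m E[of i] Hm[of i] by (simp add: norm_coeff_dilation)
  qed
  also have "fps_deriv (H ^ m) * inverse (H ^ m) = scaled_log_deriv (real m) ?b"
  proof -
    obtain l where l: "m = Suc l" using m by (cases m) auto
    have "(H ^ l) $ 0 \<noteq> 0" by (simp add: fps_power_zeroth H0)
    then have "H ^ l * inverse (H ^ l) = 1" by (rule inverse_mult_eq_1')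
    moreover have "fps_deriv (H ^ m) * inverse (H ^ m) =
        fps_const (real m) * fps_deriv H * inverse H * (H ^ l * inverse (H ^ l))"
      unfolding l fps_deriv_power diff_Suc_1 unfolding power_Suc fps_inverse_mult by (simp only: mult_ac)
    ultimately show ?thesis by (simp add: scaled_log_deriv_def H_def)
  qed
  also have "(- real d) ^ n * scaled_log_deriv (real m) ?b $ n =
      scaled_log_deriv (- 1 / real d * real m) ?b $ n"
  proof -
    have "(- 1 / real d) ^ n * (- real d) ^ n = 1"
      using n by (simp add: power_mult_distrib[symmetric])
    then have "(- real d) ^ n = 1 / (- 1 / real d) ^ n"
      using n by (simp add: field_simps)
    then show ?thesis
      using scaled_log_deriv_rescale[of ?b "- 1 / real d" "real m" n] a0 n by simp
  qed
  finally show ?thesis by simp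
qed

section \<open>Slowly varying sequences and their symbols\<close>

fun fdiff :: "nat \<Rightarrow> (nat \<Rightarrow> real) \<Rightarrow> nat \<Rightarrow> real" where
  "fdiff 0 r i = r i"
| "fdiff (Suc k) r i = fdiff k r (Suc i) - fdiff k r i"

lemma fdiff_Suc_shift: "fdiff (Suc k) r i = fdiff k (\<lambda>i. r (Suc i) - r i) i"
  by (induction k arbitrary: i) auto

lemma fdiff_shift: "fdiff k (\<lambda>i. r (Suc i)) i = fdiff k r (Suc i)"
  by (induction k arbitrary: i) auto

lemma fdiff_add: "fdiff k (\<lambda>i. r i + s i) i = fdiff k r i + fdiff k s i"
  by (induction k arbitrary: i) auto

lemma fdiff_scale: "fdiff k (\<lambda>i. c * r i) i = c * fdiff k r i"
  by (induction k arbitrary: i) (auto simp: algebra_simps)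

lemma fdiff_sum: "finite S \<Longrightarrow> fdiff k (\<lambda>i. \<Sum>x\<in>S. r x i) i = (\<Sum>x\<in>S. fdiff k (r x) i)"
  by (induction k arbitrary: i) (auto simp: sum_subtractf)

lemma fdiff_cong: "(\<And>l. l \<le> k \<Longrightarrow> r (i + l) = s (i + l)) \<Longrightarrow> fdiff k r i = fdiff k s i"
proof (induction k arbitrary: i)
  case 0
  then show ?case by force
next
  case (Suc k)
  have "fdiff k r i = fdiff k s i" using Suc.prems by (intro Suc.IH) auto
  moreover have "fdiff k r (Suc i) = fdiff k s (Suc i)"
    using Suc.prems[of "Suc _"] by (intro Suc.IH) auto
  ultimately show ?case by simp
qed

lemma newton_expansion: "r (i + n) = (\<Sum>k\<le>n. real (n choose k) * fdiff k r i)"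
proof (induction n arbitrary: i)
  case 0
  then show ?case by simp
next
  case (Suc n)
  have "r (i + Suc n) = (\<Sum>k\<le>n. real (n choose k) * fdiff k r (Suc i))"
    using Suc.IH[of "Suc i"] by simp
  also have "\<dots> = (\<Sum>k\<le>n. real (n choose k) * fdiff k r i) + (\<Sum>k\<le>n. real (n choose k) * fdiff (Suc k) r i)"
    by (simp add: sum.distrib[symmetric] algebra_simps)
  also have "(\<Sum>k\<le>n. real (n choose k) * fdiff k r i) = 
      fdiff 0 r i + (\<Sum>k\<le>n. real (n choose Suc k) * fdiff (Suc k) r i)"
  proof -
    have "(\<Sum>k\<le>n. real (n choose k) * fdiff k r i) = (\<Sum>k\<le>Suc n. real (n choose k) * fdiff k r i)"
      by simp
    then show ?thesis by (subst (asm) sum.atMost_Suc_shift) simp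
  qed
  finally show ?case
    by (subst sum.atMost_Suc_shift) (simp add: sum.distrib[symmetric] algebra_simps)
qed

text \<open>
  A family of sequences \<open>r\<^sub>x\<close> has the symbol \<open>A\<close> if \<open>r\<^sub>x(i)\<close> resembles \<open>A(\<epsilon>\<^sub>x i)\<close> to all orders.
  Asking for the same limit of the differences at every \<open>i\<close>, and not only at \<open>0\<close>, makes the notion
  invariant under shifts, which is what the product rule for differences needs.
\<close>

definition has_symbol :: "'a filter \<Rightarrow> ('a \<Rightarrow> real) \<Rightarrow> ('a \<Rightarrow> nat \<Rightarrow> real) \<Rightarrow> real fps \<Rightarrow> bool" where
  "has_symbol F \<epsilon> r A \<longleftrightarrow> (\<forall>k i. ((\<lambda>x. fdiff k (r x) i / \<epsilon> x ^ k) \<longlongrightarrow> fact k * A $ k) F)"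

lemma has_symbolD: "has_symbol F \<epsilon> r A \<Longrightarrow> ((\<lambda>x. fdiff k (r x) i / \<epsilon> x ^ k) \<longlongrightarrow> fact k * A $ k) F"
  by (simp add: has_symbol_def)

text \<open>
  A step from \<open>i\<close> to \<open>i + 1\<close> changes the \<open>k\<close>-th difference by the \<open>(k+1)\<close>-st, which is smaller by
  a factor \<open>\<epsilon>\<close>.
\<close>

lemma has_symbol_at_0I:
  assumes \<epsilon>: "(\<epsilon> \<longlongrightarrow> 0) F" "\<forall>\<^sub>F x in F. \<epsilon> x \<noteq> 0"
    and lim: "\<And>k. ((\<lambda>x. fdiff k (r x) 0 / \<epsilon> x ^ k) \<longlongrightarrow> fact k * A $ k) F"
  shows "has_symbol F \<epsilon> r A"
proof -
  have "\<forall>k. ((\<lambda>x. fdiff k (r x) i / \<epsilon> x ^ k) \<longlongrightarrow> fact k * A $ k) F" for i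
  proof (induction i)
    case 0
    then show ?case using lim by simp
  next
    case (Suc i)
    show ?case
    proof
      fix k
      have "((\<lambda>x. fdiff k (r x) i / \<epsilon> x ^ k + \<epsilon> x * (fdiff (Suc k) (r x) i / \<epsilon> x ^ Suc k))
          \<longlongrightarrow> fact k * A $ k + 0 * (fact (Suc k) * A $ Suc k)) F"
        using Suc by (intro tendsto_intros \<epsilon>) blast+
      moreover have "\<forall>\<^sub>F x in F. fdiff k (r x) i / \<epsilon> x ^ k + \<epsilon> x * (fdiff (Suc k) (r x) i / \<epsilon> x ^ Suc k) =
          fdiff k (r x) (Suc i) / \<epsilon> x ^ k"
        using \<epsilon>(2) by eventually_elim (simp add: field_simps)
      ultimately show "((\<lambda>x. fdiff k (r x) (Suc i) / \<epsilon> x ^ k) \<longlongrightarrow> fact k * A $ k) F"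
        by (simp add: tendsto_cong)
    qed
  qed
  then show ?thesis by (simp add: has_symbol_def)
qed

lemma has_symbol_shift:
  "has_symbol F \<epsilon> r A \<Longrightarrow> has_symbol F \<epsilon> (\<lambda>x i. r x (Suc i)) A"
  by (simp add: has_symbol_def fdiff_shift)

lemma has_symbol_diff_quotient:
  assumes "has_symbol F \<epsilon> r A" 
  shows "has_symbol F \<epsilon> (\<lambda>x i. (r x (Suc i) - r x i) / \<epsilon> x) (fps_deriv A)"
  unfolding has_symbol_def
proof (intro allI)
  fix k i
  have "fdiff k (\<lambda>i. (r x (Suc i) - r x i) / \<epsilon> x) i / \<epsilon> x ^ k = fdiff (Suc k) (r x) i / \<epsilon> x ^ Suc k" for x
    using fdiff_scale[of k "1 / \<epsilon> x" "\<lambda>i. r x (Suc i) - r x i" i]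
    by (simp add: fdiff_Suc_shift[symmetric] del: fdiff.simps)
  then show "((\<lambda>x. fdiff k (\<lambda>i. (r x (Suc i) - r x i) / \<epsilon> x) i / \<epsilon> x ^ k) \<longlongrightarrow> fact k * fps_deriv A $ k) F"
    using has_symbolD[OF assms, of "Suc k" i] by (simp add: algebra_simps del: fdiff.simps)
qed

text \<open>
  Difference quotients on the scale \<open>\<epsilon>\<close> correspond to derivatives of symbols. By
  \<open>\<Delta>(r s)(i) = \<Delta>r(i) s(i+1) + r(i) \<Delta>s(i)\<close> the claim for \<open>k + 1\<close> follows from the claim for
  \<open>k\<close>, applied to the products on the right, and the Leibniz rule for power series.
\<close>

lemma has_symbol_mult:
  assumes "has_symbol F \<epsilon> r A" "has_symbol F \<epsilon> s B"
  shows "has_symbol F \<epsilon> (\<lambda>x i. r x i * s x i) (A * B)"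
proof -
  have "((\<lambda>x. fdiff k (\<lambda>i. r x i * s x i) i / \<epsilon> x ^ k) \<longlongrightarrow> fact k * (A * B) $ k) F" for k i
    using assms
  proof (induction k arbitrary: r s A B)
    case 0
    from has_symbolD[OF 0(1), of 0 i] has_symbolD[OF 0(2), of 0 i] show ?case
      by (auto intro: tendsto_mult)
  next
    case (Suc k)
    let ?\<delta> = "\<lambda>r x i. (r x (Suc i) - r x i) / \<epsilon> x"
    have "((\<lambda>x. fdiff k (\<lambda>i. ?\<delta> r x i * s x (Suc i)) i / \<epsilon> x ^ k + fdiff k (\<lambda>i. r x i * ?\<delta> s x i) i / \<epsilon> x ^ k)
       \<longlongrightarrow> fact k * (fps_deriv A * B) $ k + fact k * (A * fps_deriv B) $ k) F"
      using Suc.prems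
      by (intro tendsto_add Suc.IH has_symbol_diff_quotient has_symbol_shift) auto
    moreover have "fdiff k (\<lambda>i. ?\<delta> r x i * s x (Suc i)) i / \<epsilon> x ^ k + fdiff k (\<lambda>i. r x i * ?\<delta> s x i) i / \<epsilon> x ^ k
      = fdiff (Suc k) (\<lambda>i. r x i * s x i) i / \<epsilon> x ^ Suc k" for x
    proof -
      have "fdiff (Suc k) (\<lambda>i. r x i * s x i) i / \<epsilon> x =
          fdiff k (\<lambda>i. 1 / \<epsilon> x * (r x (Suc i) * s x (Suc i) - r x i * s x i)) i"
        by (simp only: fdiff_scale fdiff_Suc_shift) simp
      also have "(\<lambda>i. 1 / \<epsilon> x * (r x (Suc i) * s x (Suc i) - r x i * s x i)) =
          (\<lambda>i. ?\<delta> r x i * s x (Suc i) + r x i * ?\<delta> s x i)"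
        by (auto simp: divide_inverse algebra_simps)
      finally have *: "fdiff (Suc k) (\<lambda>i. r x i * s x i) i / \<epsilon> x =
          fdiff k (\<lambda>i. ?\<delta> r x i * s x (Suc i)) i + fdiff k (\<lambda>i. r x i * ?\<delta> s x i) i"
        unfolding fdiff_add .
      show ?thesis
        unfolding add_divide_distrib[symmetric] *[symmetric] by (simp del: fdiff.simps)
    qed
    moreover have "fact k * (fps_deriv A * B) $ k + fact k * (A * fps_deriv B) $ k = fact (Suc k) * (A * B) $ Suc k"
    proof -
      have "(fps_deriv A * B) $ k + (A * fps_deriv B) $ k = real (Suc k) * (A * B) $ Suc k"
        using fps_deriv_nth[of "A * B" k] by (simp add: algebra_simps del: fps_deriv_nth)
      then have "fact k * ((fps_deriv A * B) $ k + (A * fps_deriv B) $ k) = fact k * (real (Suc k) * (A * B) $ Suc k)"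
        by simp
      then show ?thesis by (simp only: distrib_left fact_Suc of_nat_mult mult_ac)
    qed
    ultimately show ?case by simp
  qed
  then show ?thesis by (simp add: has_symbol_def)
qed

lemma has_symbol_const: "has_symbol F \<epsilon> (\<lambda>x i. c) (fps_const c)"
proof -
  have 0: "fdiff k (\<lambda>i. c) i = (if k = 0 then c else 0)" for k i
    by (induction k arbitrary: i) auto
  show ?thesis
    unfolding has_symbol_def
  proof (intro allI)
    fix k i
    show "((\<lambda>x. fdiff k (\<lambda>i. c) i / \<epsilon> x ^ k) \<longlongrightarrow> fact k * fps_const c $ k) F"
      by (cases "k = 0") (auto simp: 0)
  qed
qed

lemma has_symbol_add:
  assumes "has_symbol F \<epsilon> r A" "has_symbol F \<epsilon> s B"
  shows "has_symbol F \<epsilon> (\<lambda>x i. r x i + s x i) (A + B)"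
  using assms unfolding has_symbol_def
  by (auto simp: fdiff_add add_divide_distrib algebra_simps intro!: tendsto_add)

lemma has_symbol_power:
  assumes "has_symbol F \<epsilon> r A"
  shows "has_symbol F \<epsilon> (\<lambda>x i. r x i ^ n) (A ^ n)"
proof (induction n)
  case 0
  then show ?case using has_symbol_const[of F \<epsilon> 1] by simp
next
  case (Suc n)
  then show ?case using has_symbol_mult[OF assms] by simp
qed

lemma has_symbol_cong:
  assumes "\<And>i. \<forall>\<^sub>F x in F. r x i = s x i" "has_symbol F \<epsilon> r A"
  shows "has_symbol F \<epsilon> s A"
  unfolding has_symbol_def
proof (intro allI)
  fix k i
  have "\<forall>\<^sub>F x in F. \<forall>l\<in>{..k}. r x (i + l) = s x (i + l)"
    using assms(1) by (intro eventually_ball_finite) auto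
  then have "\<forall>\<^sub>F x in F. fdiff k (r x) i / \<epsilon> x ^ k = fdiff k (s x) i / \<epsilon> x ^ k"
  proof eventually_elim
    case (elim x)
    then have "fdiff k (r x) i = fdiff k (s x) i" by (intro fdiff_cong) auto
    then show ?case by simp
  qed
  then show "((\<lambda>x. fdiff k (s x) i / \<epsilon> x ^ k) \<longlongrightarrow> fact k * A $ k) F"
    by (rule Lim_transform_eventually[OF has_symbolD[OF assms(2)]])
qed

text \<open>
  The differences are explicit:
  \<open>\<Delta>^k (1 / (1 + e i)) = (-1)^k k! e^k / ((1 + e i) \<dots> (1 + e (i + k)))\<close>.
\<close>

lemma has_symbol_reciprocal:
  assumes \<epsilon>: "(\<epsilon> \<longlongrightarrow> 0) F" "\<forall>\<^sub>F x in F. \<epsilon> x \<noteq> 0"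
  shows "has_symbol F \<epsilon> (\<lambda>x i. 1 / (1 + \<epsilon> x * real i)) (Abs_fps (\<lambda>k. (-1) ^ k))"
  unfolding has_symbol_def
proof (intro allI)
  fix k i
  have lim: "((\<lambda>x. 1 + \<epsilon> x * real l) \<longlongrightarrow> 1) F" for l
    using tendsto_add[OF tendsto_const tendsto_mult[OF \<epsilon>(1) tendsto_const]] by simp
  have nz: "\<forall>\<^sub>F x in F. 1 + \<epsilon> x * real l \<noteq> 0" for l
    using lim[of l] tendsto_imp_eventually_ne[of _ 1] by fastforce
  have formula: "fdiff k (\<lambda>i. 1 / (1 + e * real i)) i = (-1) ^ k * fact k * e ^ k / (\<Prod>l\<le>k. 1 + e * real (i + l))"
    if "\<forall>l\<le>k. 1 + e * real (i + l) \<noteq> 0" for e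
    using that
  proof (induction k arbitrary: i)
    case (Suc k)
    let ?P = "\<Prod>l\<le>k. 1 + e * real (Suc i + l)"
    let ?Q = "\<Prod>l\<le>k. 1 + e * real (i + l)"
    let ?c = "(-1) ^ k * fact k * e ^ k"
    have nz: "?P \<noteq> 0" "?Q \<noteq> 0" "1 + e * real (i + Suc k) \<noteq> 0" "1 + e * real i \<noteq> 0"
      using Suc.prems[rule_format, of "Suc _"] Suc.prems[rule_format, of 0] Suc.prems by auto
    have PQ: "?Q * (1 + e * real (i + Suc k)) = (1 + e * real i) * ?P"
      using prod.atMost_Suc_shift[of "\<lambda>l. 1 + e * real (i + l)" k] by (simp add: ac_simps)
    have "fdiff k (\<lambda>i. 1 / (1 + e * real i)) (Suc i) = ?c / ?P"
      using Suc.prems[rule_format, of "Suc _"] by (intro Suc.IH) auto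
    moreover have "fdiff k (\<lambda>i. 1 / (1 + e * real i)) i = ?c / ?Q"
      using Suc.prems by (intro Suc.IH) auto
    ultimately have "fdiff (Suc k) (\<lambda>i. 1 / (1 + e * real i)) i = ?c / ?P - ?c / ?Q"
      by simp
    also have "?c / ?P = ?c * (1 + e * real i) / (?Q * (1 + e * real (i + Suc k)))"
      unfolding PQ using nz by simp
    also have "?c / ?Q = ?c * (1 + e * real (i + Suc k)) / (?Q * (1 + e * real (i + Suc k)))"
      using nz by simp
    also have "?c * (1 + e * real i) / (?Q * (1 + e * real (i + Suc k))) - 
       ?c * (1 + e * real (i + Suc k)) / (?Q * (1 + e * real (i + Suc k))) =
       (?c * (1 + e * real i) - ?c * (1 + e * real (i + Suc k))) / (?Q * (1 + e * real (i + Suc k)))"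
      by (rule diff_divide_distrib[symmetric])
    also have "?c * (1 + e * real i) - ?c * (1 + e * real (i + Suc k)) = (-1) ^ Suc k * fact (Suc k) * e ^ Suc k"
      by (simp add: algebra_simps)
    finally show ?case by simp
  qed simp
  have "((\<lambda>x. (-1) ^ k * fact k / (\<Prod>l\<le>k. 1 + \<epsilon> x * real (i + l))) \<longlongrightarrow> (-1) ^ k * fact k / (\<Prod>l\<le>k. 1)) F"
    by (intro tendsto_divide tendsto_const tendsto_prod lim) auto
  moreover have "\<forall>\<^sub>F x in F. \<forall>l\<in>{..k}. 1 + \<epsilon> x * real (i + l) \<noteq> 0"
    by (intro eventually_ball_finite ballI nz) auto
  then have "\<forall>\<^sub>F x in F. (-1) ^ k * fact k / (\<Prod>l\<le>k. 1 + \<epsilon> x * real (i + l)) =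
      fdiff k (\<lambda>i. 1 / (1 + \<epsilon> x * real i)) i / \<epsilon> x ^ k"
    using \<epsilon>(2) by eventually_elim (simp add: formula)
  ultimately show "((\<lambda>x. fdiff k (\<lambda>i. 1 / (1 + \<epsilon> x * real i)) i / \<epsilon> x ^ k) \<longlongrightarrow>
      fact k * Abs_fps (\<lambda>k. (-1) ^ k) $ k) F"
    by (simp add: tendsto_cong mult.commute)
qed

section \<open>The symbol of a large power\<close>

lemma prod_one_minus_over:
  assumes "d > 0"
  shows "(\<Prod>l<k. 1 - real l / real d) = fact k * real (d choose k) / real d ^ k"
proof -
  have "(\<Prod>l<k. 1 - real l / real d) = (\<Prod>l<k. (real d - real l) / real d)"
    using assms by (intro prod.cong) (auto simp: field_simps)
  then show ?thesis
    by (simp add: binomial_gbinomial gbinomial_prod_rev prod_dividef atLeast0LessThan)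
qed

lemma choose_over_power_tendsto:
  "(\<lambda>m. real (m choose k) / real m ^ k) \<longlonglongrightarrow> 1 / fact k"
proof -
  have "(\<lambda>m. (\<Prod>l<k. 1 - real l / real m) / fact k) \<longlonglongrightarrow> (\<Prod>l<k. 1 - 0) / fact k"
    by (intro tendsto_intros lim_const_over_n) auto
  moreover have "\<forall>\<^sub>F m in sequentially. (\<Prod>l<k. 1 - real l / real m) / fact k = real (m choose k) / real m ^ k"
    using eventually_gt_at_top[of 0]
    by eventually_elim (simp add: prod_one_minus_over)
  ultimately show ?thesis
    by (simp add: tendsto_cong)
qed

text \<open>
  By \<open>(m choose (j + k + 1)) \<le> m^(j+k+1) / j!\<close> the tail is dominated by \<open>y^(k+1)\<close> times the
  exponential series, where \<open>y = m |v|\<close>.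
\<close>

lemma binomial_tail_bound:
  fixes v :: real
  shows "\<bar>(1 + v) ^ m - (\<Sum>j\<le>k. real (m choose j) * v ^ j)\<bar> \<le> (real m * \<bar>v\<bar>) ^ Suc k * exp (real m * \<bar>v\<bar>)"
proof -
  let ?y = "real m * \<bar>v\<bar>"
  \<comment> \<open>The binomial coefficients beyond \<open>m\<close> vanish; the longer range avoids the case \<open>m \<le> k\<close>.\<close>
  have full: "(1 + v) ^ m = (\<Sum>j\<le>m + Suc k. real (m choose j) * v ^ j)"
  proof -
    have "(1 + v) ^ m = (\<Sum>j\<le>m. real (m choose j) * v ^ j)"
      using binomial_ring[of v 1 m] by (simp add: add.commute)
    also have "\<dots> = (\<Sum>j\<le>m + Suc k. real (m choose j) * v ^ j)"
      by (intro sum.mono_neutral_left) auto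
    finally show ?thesis .
  qed
  have split: "{..m + Suc k} = {..k} \<union> {Suc k..m + Suc k}" by auto
  have "(1 + v) ^ m - (\<Sum>j\<le>k. real (m choose j) * v ^ j) = (\<Sum>j=Suc k..m + Suc k. real (m choose j) * v ^ j)"
    unfolding full split by (subst sum.union_disjoint) auto
  also have "\<dots> = (\<Sum>j=0..m. real (m choose (j + Suc k)) * v ^ (j + Suc k))"
    using sum.shift_bounds_cl_nat_ivl[of "\<lambda>j. real (m choose j) * v ^ j" 0 "Suc k" m] by simp
  also have "\<bar>\<dots>\<bar> \<le> (\<Sum>j=0..m. ?y ^ Suc k * (?y ^ j /\<^sub>R fact j))"
  proof (intro order.trans[OF sum_abs] sum_mono)
    fix j
    have "real (m choose (j + Suc k)) * fact j \<le> real (m choose (j + Suc k)) * fact (j + Suc k)"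
      by (intro mult_left_mono fact_mono) auto
    also have "\<dots> \<le> real m ^ (j + Suc k)"
      using binomial_fact_pow[of m "j + Suc k"]
      by (metis of_nat_fact of_nat_le_iff of_nat_mult of_nat_power)
    finally have "real (m choose (j + Suc k)) \<le> real m ^ (j + Suc k) / fact j"
      by (simp add: field_simps del: add_Suc_right)
    then have "real (m choose (j + Suc k)) * \<bar>v\<bar> ^ (j + Suc k) \<le> real m ^ (j + Suc k) / fact j * \<bar>v\<bar> ^ (j + Suc k)"
      by (intro mult_right_mono) auto
    then show "\<bar>real (m choose (j + Suc k)) * v ^ (j + Suc k)\<bar> \<le> ?y ^ Suc k * (?y ^ j /\<^sub>R fact j)"
      by (simp add: abs_mult power_abs power_mult_distrib power_add field_simps)
  qed
  also have "\<dots> \<le> ?y ^ Suc k * exp ?y"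
    unfolding sum_distrib_left[symmetric] exp_def
    by (intro mult_left_mono sum_le_suminf summable_exp_generic) auto
  finally show ?thesis .
qed

text \<open>
  Write \<open>r = 1 + v\<close> and expand \<open>(1 + v)^m\<close> binomially. On the scale \<open>m \<epsilon>\<close> the \<open>k\<close>-th difference of
  \<open>(m choose j) v^j\<close> is of order \<open>m^(j-k)\<close>, so it vanishes in the limit for \<open>j < k\<close>. For
  \<open>j = k\<close> the binomial coefficient behaves like \<open>m^k / k!\<close>, and the symbol of \<open>v^k\<close> starts with
  \<open>(A\<^sub>1 s)^k\<close> because \<open>v\<close> vanishes at \<open>0\<close>. The terms with \<open>j > k\<close> are together of order
  \<open>(m \<epsilon>)^(k+1)\<close>, because \<open>v\<close> is of order \<open>\<epsilon>\<close> at every fixed index.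
\<close>

lemma has_symbol_large_power:
  fixes m :: "'a \<Rightarrow> nat"
  assumes bot: "F \<noteq> bot" and \<epsilon>: "(\<epsilon> \<longlongrightarrow> 0) F" "\<forall>\<^sub>F x in F. \<epsilon> x \<noteq> 0"
    and m: "filterlim m at_top F" "((\<lambda>x. real (m x) * \<epsilon> x) \<longlongrightarrow> 0) F"
    and r: "has_symbol F \<epsilon> r A" and r0: "\<forall>\<^sub>F x in F. r x 0 = 1"
  shows "has_symbol F (\<lambda>x. real (m x) * \<epsilon> x) (\<lambda>x i. r x i ^ m x) (fps_exp (A $ 1))"
proof -
  define v where "v x i = r x i + (-1)" for x i
  define V where "V = A + fps_const (-1)"
  have v: "has_symbol F \<epsilon> v V"
    unfolding v_def V_def by (intro has_symbol_add has_symbol_const r)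
  have mpos: "\<forall>\<^sub>F x in F. m x > 0"
    using eventually_compose_filterlim[OF eventually_gt_at_top m(1)] .
  have V0: "V $ 0 = 0"
  proof -
    have "((\<lambda>x. v x 0) \<longlongrightarrow> V $ 0) F" using has_symbolD[OF v, of 0 0] by simp
    moreover have "((\<lambda>x. v x 0) \<longlongrightarrow> 0) F"
      using r0 by (intro tendsto_eventually) (auto simp: v_def elim: eventually_mono)
    ultimately show ?thesis using bot tendsto_unique by blast
  qed
  show ?thesis
  proof (rule has_symbol_at_0I)
    show "((\<lambda>x. real (m x) * \<epsilon> x) \<longlongrightarrow> 0) F" by (rule m)
    show "\<forall>\<^sub>F x in F. real (m x) * \<epsilon> x \<noteq> 0"
      using \<epsilon>(2) mpos by eventually_elim simp
    fix k
    define tail where "tail x i = r x i ^ m x - (\<Sum>j\<le>k. real (m x choose j) * v x i ^ j)" for x i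
    have main: "((\<lambda>x. \<Sum>j\<le>k. real (m x choose j) / real (m x) ^ k * (fdiff k (\<lambda>i. v x i ^ j) 0 / \<epsilon> x ^ k))
      \<longlongrightarrow> (\<Sum>j\<le>k. (if j = k then 1 / fact k else 0) * (fact k * (V ^ j) $ k))) F"
    proof (intro tendsto_sum tendsto_mult has_symbolD has_symbol_power v)
      fix j assume j: "j \<in> {..k}"
      have "((\<lambda>n. real (n choose j) / real n ^ j * (1 / real n) ^ (k - j)) \<longlongrightarrow> 1 / fact j * 0 ^ (k - j)) sequentially"
        by (intro tendsto_mult choose_over_power_tendsto tendsto_power lim_const_over_n)
      also have "(\<lambda>n. real (n choose j) / real n ^ j * (1 / real n) ^ (k - j)) = (\<lambda>n. real (n choose j) / real n ^ k)"
        using j by (auto simp: power_one_over power_add[symmetric] field_simps)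
      also have "1 / fact j * 0 ^ (k - j) = (if j = k then 1 / fact k else (0::real))"
        using j by auto
      finally show "((\<lambda>x. real (m x choose j) / real (m x) ^ k) \<longlongrightarrow> (if j = k then 1 / fact k else 0)) F"
        by (rule filterlim_compose[OF _ m(1)])
    qed
    have "(\<Sum>j\<le>k. (if j = k then 1 / fact k else 0) * (fact k * (V ^ j) $ k)) = (V ^ k) $ k"
      by (simp add: sum.delta if_distrib[of "\<lambda>c. c * _"] cong: if_cong)
    also have "\<dots> = (A $ 1) ^ k"
      using startsby_zero_power_nth_same[OF V0, of k] by (simp add: V_def)
    finally have main': "((\<lambda>x. \<Sum>j\<le>k. real (m x choose j) / real (m x) ^ k * (fdiff k (\<lambda>i. v x i ^ j) 0 / \<epsilon> x ^ k))
      \<longlongrightarrow> (A $ 1) ^ k) F"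
      using main by simp
    have tail0: "((\<lambda>x. tail x i / (real (m x) * \<epsilon> x) ^ k) \<longlongrightarrow> 0) F" for i
    proof -
      \<comment> \<open>Newton's formula at \<open>0\<close> without its constant term \<open>v(0) = 0\<close>\<close>
      have vq: "((\<lambda>x. v x i / \<epsilon> x) \<longlongrightarrow> real i * V $ 1) F"
      proof -
        have lim: "((\<lambda>x. (\<Sum>l\<in>{1..i}. real (i choose l) * \<epsilon> x ^ (l - 1) * (fdiff l (v x) 0 / \<epsilon> x ^ l))) \<longlongrightarrow>
          (\<Sum>l\<in>{1..i}. real (i choose l) * 0 ^ (l - 1) * (fact l * V $ l))) F"
          by (intro tendsto_intros \<epsilon> has_symbolD v)
        have eq: "(\<Sum>l\<in>{1..i}. real (i choose l) * 0 ^ (l - 1) * (fact l * V $ l)) = real i * V $ 1"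
        proof (cases i)
          case (Suc i')
          have "(\<Sum>l\<in>{1..i}. real (i choose l) * 0 ^ (l - 1) * (fact l * V $ l)) =
            (\<Sum>l\<in>{1}. real (i choose l) * 0 ^ (l - 1) * (fact l * V $ l))"
            using Suc by (intro sum.mono_neutral_right) auto
          then show ?thesis by simp
        qed simp
        have "\<forall>\<^sub>F x in F. (\<Sum>l\<in>{1..i}. real (i choose l) * \<epsilon> x ^ (l - 1) * (fdiff l (v x) 0 / \<epsilon> x ^ l)) = v x i / \<epsilon> x"
          using \<epsilon>(2) r0
        proof eventually_elim
          case (elim x)
          have "v x (0 + i) = (\<Sum>l\<in>insert 0 {1..i}. real (i choose l) * fdiff l (v x) 0)"
            unfolding newton_expansion by (intro sum.cong) auto
          also have "\<dots> = (\<Sum>l\<in>{1..i}. real (i choose l) * fdiff l (v x) 0)"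
            using elim by (subst sum.insert) (auto simp: v_def)
          finally have "v x i / \<epsilon> x = (\<Sum>l\<in>{1..i}. real (i choose l) * fdiff l (v x) 0 / \<epsilon> x)"
            by (simp add: sum_divide_distrib)
          also have "\<dots> = (\<Sum>l\<in>{1..i}. real (i choose l) * \<epsilon> x ^ (l - 1) * (fdiff l (v x) 0 / \<epsilon> x ^ l))"
          proof (intro sum.cong refl)
            fix l assume "l \<in> {1..i}"
            then obtain l' where "l = Suc l'" by (cases l) auto
            then show "real (i choose l) * fdiff l (v x) 0 / \<epsilon> x = real (i choose l) * \<epsilon> x ^ (l - 1) * (fdiff l (v x) 0 / \<epsilon> x ^ l)"
              using elim(1) by (simp add: field_simps del: fdiff.simps)
          qed
          finally show ?case by simp
        qed
        then show ?thesis
          by (rule Lim_transform_eventually[OF lim[unfolded eq]])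
      qed
      have mv: "((\<lambda>x. real (m x) * \<bar>v x i\<bar>) \<longlongrightarrow> 0) F"
      proof -
        have "((\<lambda>x. \<bar>real (m x) * \<epsilon> x\<bar> * \<bar>v x i / \<epsilon> x\<bar>) \<longlongrightarrow> \<bar>0\<bar> * \<bar>real i * V $ 1\<bar>) F"
          by (intro tendsto_mult tendsto_rabs vq m)
        moreover have "\<forall>\<^sub>F x in F. \<bar>real (m x) * \<epsilon> x\<bar> * \<bar>v x i / \<epsilon> x\<bar> = real (m x) * \<bar>v x i\<bar>"
          using \<epsilon>(2) by eventually_elim (simp add: abs_mult)
        ultimately show ?thesis by (simp add: tendsto_cong)
      qed
      have "((\<lambda>x. \<bar>v x i / \<epsilon> x\<bar> ^ k * (real (m x) * \<bar>v x i\<bar>) * exp (real (m x) * \<bar>v x i\<bar>)) \<longlongrightarrow>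
          \<bar>real i * V $ 1\<bar> ^ k * 0 * exp 0) F"
        by (intro tendsto_mult tendsto_exp mv tendsto_power tendsto_rabs vq)
      then have lim: "((\<lambda>x. \<bar>v x i / \<epsilon> x\<bar> ^ k * (real (m x) * \<bar>v x i\<bar>) * exp (real (m x) * \<bar>v x i\<bar>)) \<longlongrightarrow> 0) F"
        by simp
      show ?thesis
      proof (rule Lim_null_comparison[OF _ lim])
        show "\<forall>\<^sub>F x in F. norm (tail x i / (real (m x) * \<epsilon> x) ^ k) \<le>
            \<bar>v x i / \<epsilon> x\<bar> ^ k * (real (m x) * \<bar>v x i\<bar>) * exp (real (m x) * \<bar>v x i\<bar>)"
          using \<epsilon>(2) mpos
        proof eventually_elim
          case (elim x)
          have "\<bar>tail x i\<bar> \<le> (real (m x) * \<bar>v x i\<bar>) ^ Suc k * exp (real (m x) * \<bar>v x i\<bar>)"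
            using binomial_tail_bound[of "v x i" "m x" k] by (simp add: tail_def v_def)
          then have "\<bar>tail x i\<bar> / \<bar>real (m x) * \<epsilon> x\<bar> ^ k \<le>
              (real (m x) * \<bar>v x i\<bar>) ^ Suc k * exp (real (m x) * \<bar>v x i\<bar>) / \<bar>real (m x) * \<epsilon> x\<bar> ^ k"
            by (intro divide_right_mono) auto
          also have "\<dots> = \<bar>v x i / \<epsilon> x\<bar> ^ k * (real (m x) * \<bar>v x i\<bar>) * exp (real (m x) * \<bar>v x i\<bar>)"
            using elim by (simp add: power_mult_distrib abs_mult power_divide)
          finally show ?case by (simp add: power_abs)
        qed
      qed
    qed
    have "((\<lambda>x. fdiff k (tail x) 0 / (real (m x) * \<epsilon> x) ^ k) \<longlongrightarrow> 0) F"
    proof -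
      have "((\<lambda>x. fdiff l (tail x) i / (real (m x) * \<epsilon> x) ^ k) \<longlongrightarrow> 0) F" for l i
      proof (induction l arbitrary: i)
        case (Suc l)
        from tendsto_diff[OF Suc[of "Suc i"] Suc[of i]] show ?case
          by (simp add: diff_divide_distrib)
      qed (simp add: tail0)
      then show ?thesis by simp
    qed
    from tendsto_add[OF main' this]
    have "((\<lambda>x. (\<Sum>j\<le>k. real (m x choose j) / real (m x) ^ k * (fdiff k (\<lambda>i. v x i ^ j) 0 / \<epsilon> x ^ k)) +
       fdiff k (tail x) 0 / (real (m x) * \<epsilon> x) ^ k) \<longlongrightarrow> (A $ 1) ^ k) F" by simp
    also have "(\<lambda>x. (\<Sum>j\<le>k. real (m x choose j) / real (m x) ^ k * (fdiff k (\<lambda>i. v x i ^ j) 0 / \<epsilon> x ^ k)) +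
       fdiff k (tail x) 0 / (real (m x) * \<epsilon> x) ^ k) = (\<lambda>x. fdiff k (\<lambda>i. r x i ^ m x) 0 / (real (m x) * \<epsilon> x) ^ k)"
    proof
      fix x
      have "fdiff k (\<lambda>i. r x i ^ m x) 0 = fdiff k (\<lambda>i. (\<Sum>j\<le>k. real (m x choose j) * v x i ^ j) + tail x i) 0"
        by (simp add: tail_def)
      also have "\<dots> = (\<Sum>j\<le>k. real (m x choose j) * fdiff k (\<lambda>i. v x i ^ j) 0) + fdiff k (tail x) 0"
        by (simp add: fdiff_add fdiff_sum fdiff_scale)
      finally show "(\<Sum>j\<le>k. real (m x choose j) / real (m x) ^ k * (fdiff k (\<lambda>i. v x i ^ j) 0 / \<epsilon> x ^ k)) +
       fdiff k (tail x) 0 / (real (m x) * \<epsilon> x) ^ k = fdiff k (\<lambda>i. r x i ^ m x) 0 / (real (m x) * \<epsilon> x) ^ k"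
        by (simp add: add_divide_distrib sum_divide_distrib power_mult_distrib)
    qed
    finally show "((\<lambda>x. fdiff k (\<lambda>i. r x i ^ m x) 0 / (real (m x) * \<epsilon> x) ^ k) \<longlongrightarrow> fact k * fps_exp (A $ 1) $ k) F"
      by simp
  qed
qed

section \<open>Symbols of ratios and logarithmic derivatives\<close>

text \<open>
  These are the quotients \<open>f^(k) / f\<close> (derivatives in \<open>x\<close>, expressed in \<open>z = e x\<close>), as differential
  polynomials in \<open>\<Psi> = f'/f\<close>. In the limit \<open>e \<rightarrow> 0\<close> they become the powers of \<open>\<Psi>\<close>.
\<close>

fun riccati_iterate :: "real \<Rightarrow> real fps \<Rightarrow> nat \<Rightarrow> real fps" where
  "riccati_iterate e \<Psi> 0 = 1"
| "riccati_iterate e \<Psi> (Suc k) = fps_const e * fps_deriv (riccati_iterate e \<Psi> k) + \<Psi> * riccati_iterate e \<Psi> k"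

lemma riccati_iterate_log_deriv:
  assumes "b 0 = 1"
  shows "riccati_iterate e (scaled_log_deriv e b) k =
    fps_const (e ^ k) * fps_nth_deriv k (scaled_egf e b) * inverse (scaled_egf e b)"
proof (induction k)
  case 0
  have "scaled_egf e b $ 0 \<noteq> 0" using assms by (simp add: scaled_egf_def)
  then show ?case by (simp add: inverse_mult_eq_1')
next
  case (Suc k)
  let ?B = "scaled_egf e b"
  have "?B $ 0 \<noteq> 0" using assms by (simp add: scaled_egf_def)
  then have inv: "fps_deriv (inverse ?B) = - fps_deriv ?B * (inverse ?B)\<^sup>2"
    by (rule fps_inverse_deriv)
  show ?case
    unfolding riccati_iterate.simps Suc.IH fps_nth_deriv_commute
    by (simp add: scaled_log_deriv_def inv power2_eq_square fps_const_mult[symmetric] algebra_simps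
        del: fps_const_mult)
qed

lemma fps_nth_deriv_nth: "fps_nth_deriv k f $ n = (fact (n + k) / fact n :: real) * f $ (n + k)"
proof (induction k arbitrary: f)
  case (Suc k)
  show ?case by (simp add: Suc.IH field_simps)
qed simp

lemma riccati_iterate_nth_0:
  assumes "b 0 = 1" "e \<noteq> 0"
  shows "riccati_iterate e (scaled_log_deriv e b) k $ 0 = b k"
  using assms(2)
  by (simp add: riccati_iterate_log_deriv[of b, OF assms(1)] fps_nth_deriv_nth scaled_egf_def assms(1))

text \<open>
  Newton's formula for \<open>r\<close> at \<open>0\<close> turns the recursion for \<open>b\<close> into the differential equation
  \<open>f' = \<Sum>\<^sub>k (\<Delta>^k r(0) / k!) x^k f^(k)\<close>, because \<open>x^k f^(k)\<close> has the coefficients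
  \<open>k! (i choose k) b\<^sub>i / i!\<close>. Dividing by \<open>f\<close> keeps the equation valid up to the order \<open>n\<close> to
  which the recursion is assumed.
\<close>

lemma scaled_log_deriv_eq_ratio_sum:
  assumes b0: "b 0 = 1" and e: "e \<noteq> 0" and r: "\<And>i. i \<le> n \<Longrightarrow> b (Suc i) = r i * b i"
  shows "scaled_log_deriv e b $ n =
    (\<Sum>k\<le>n. fdiff k r 0 / (fact k * e ^ k) * riccati_iterate e (scaled_log_deriv e b) k $ (n - k))"
proof -
  let ?B = "scaled_egf e b"
  define c where "c k = fdiff k r 0 / (fact k * e ^ k)" for k
  define S where "S = (\<Sum>k\<le>n. fps_const (c k) * (fps_X ^ k * (fps_const (e ^ k) * fps_nth_deriv k ?B)))"
  have S: "(fps_const e * fps_deriv ?B) $ i = S $ i" if i: "i \<le> n" for i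
  proof -
    have "S $ i = (\<Sum>k\<le>n. if i < k then 0 else real (i choose k) * fdiff k r 0 * (b i / (fact i * e ^ i)))"
      unfolding S_def fps_sum_nth
    proof (intro sum.cong refl)
      fix k
      show "(fps_const (c k) * (fps_X ^ k * (fps_const (e ^ k) * fps_nth_deriv k ?B))) $ i =
        (if i < k then 0 else real (i choose k) * fdiff k r 0 * (b i / (fact i * e ^ i)))"
        using e by (auto simp: fps_X_power_mult_nth fps_nth_deriv_nth scaled_egf_def c_def binomial_fact)
    qed
    also have "\<dots> = (\<Sum>k\<le>i. real (i choose k) * fdiff k r 0 * (b i / (fact i * e ^ i)))"
      using i by (intro sum.mono_neutral_cong_right) auto
    also have "\<dots> = r i * (b i / (fact i * e ^ i))"
      unfolding sum_distrib_right[symmetric] using newton_expansion[of r 0 i] by simp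
    also have "\<dots> = (fps_const e * fps_deriv ?B) $ i"
      using e r[OF i] by (simp add: scaled_egf_def field_simps del: of_nat_Suc)
    finally show ?thesis ..
  qed
  have "scaled_log_deriv e b $ n = (S * inverse ?B) $ n"
    unfolding scaled_log_deriv_def fps_mult_nth[of "fps_const e * fps_deriv ?B"] fps_mult_nth[of S]
    by (intro sum.cong) (simp_all only: S atLeastAtMost_iff)
  also have "S * inverse ?B =
      (\<Sum>k\<le>n. fps_const (c k) * (fps_X ^ k * riccati_iterate e (scaled_log_deriv e b) k))"
    unfolding S_def sum_distrib_right by (simp add: riccati_iterate_log_deriv[of b] b0 mult.assoc)
  finally show ?thesis
    by (auto simp: fps_sum_nth fps_X_power_mult_nth c_def intro!: sum.cong)
qed

text \<open>
  Only the coefficients of \<open>\<Psi>\<close> below \<open>j + k\<close> enter. This bound makes the two lemmas that follow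
  inductions over triangular systems.
\<close>

lemma riccati_iterate_tendsto:
  assumes \<epsilon>: "(\<epsilon> \<longlongrightarrow> 0) F"
    and \<Psi>: "\<And>i. i < j + k \<Longrightarrow> ((\<lambda>x. \<Psi> x $ i) \<longlongrightarrow> U $ i) F"
  shows "((\<lambda>x. riccati_iterate (\<epsilon> x) (\<Psi> x) k $ j) \<longlongrightarrow> (U ^ k) $ j) F"
  using \<Psi>
proof (induction k arbitrary: j)
  case (Suc k)
  let ?P = "\<lambda>x. riccati_iterate (\<epsilon> x) (\<Psi> x) k"
  have IH: "((\<lambda>x. ?P x $ i) \<longlongrightarrow> (U ^ k) $ i) F" if "i \<le> Suc j" for i
    using that Suc.prems by (intro Suc.IH) auto
  have "((\<lambda>x. \<epsilon> x * (real (Suc j) * ?P x $ Suc j) + (\<Sum>i=0..j. \<Psi> x $ i * ?P x $ (j - i)))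
      \<longlongrightarrow> 0 * (real (Suc j) * (U ^ k) $ Suc j) + (\<Sum>i=0..j. U $ i * (U ^ k) $ (j - i))) F"
    using Suc.prems by (intro tendsto_intros \<epsilon> IH) auto
  then show ?case
    unfolding riccati_iterate.simps power_Suc fps_add_nth mult.assoc fps_mult_left_const_nth
      fps_deriv_nth fps_mult_nth[of "\<Psi> _"] fps_mult_nth[of U]
    by simp
qed simp

text \<open>
  The right-hand side of the equation for the coefficient of order \<open>n\<close> only involves
  coefficients of lower order, so the limits follow by induction. The hypothesis on \<open>U\<close> is the
  equation \<open>U = W(z U)\<close>, read off at each order.
\<close>

lemma log_deriv_limit_from_symbol:
  assumes \<epsilon>: "(\<epsilon> \<longlongrightarrow> 0) F" "\<forall>\<^sub>F x in F. \<epsilon> x \<noteq> 0"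
    and b0: "\<forall>\<^sub>F x in F. b x 0 = 1"
    and ratio: "\<And>i. \<forall>\<^sub>F x in F. b x (Suc i) = r x i * b x i"
    and r: "has_symbol F \<epsilon> r W"
    and U: "\<And>n. U $ n = (\<Sum>k\<le>n. W $ k * (U ^ k) $ (n - k))"
  shows "((\<lambda>x. scaled_log_deriv (\<epsilon> x) (b x) $ n) \<longlongrightarrow> U $ n) F"
proof (induction n rule: less_induct)
  case (less n)
  let ?\<Psi> = "\<lambda>x. scaled_log_deriv (\<epsilon> x) (b x)"
  have lim: "((\<lambda>x. \<Sum>k\<le>n. fdiff k (r x) 0 / \<epsilon> x ^ k / fact k * riccati_iterate (\<epsilon> x) (?\<Psi> x) k $ (n - k))
      \<longlongrightarrow> (\<Sum>k\<le>n. fact k * W $ k / fact k * (U ^ k) $ (n - k))) F"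
    using less by (intro tendsto_intros has_symbolD[OF r] riccati_iterate_tendsto \<epsilon>) auto
  have "\<forall>\<^sub>F x in F. \<forall>i\<in>{..n}. b x (Suc i) = r x i * b x i"
    by (intro eventually_ball_finite ballI ratio) auto
  then have "\<forall>\<^sub>F x in F. (\<Sum>k\<le>n. fdiff k (r x) 0 / \<epsilon> x ^ k / fact k * riccati_iterate (\<epsilon> x) (?\<Psi> x) k $ (n - k)) = ?\<Psi> x $ n"
    using \<epsilon>(2) b0
  proof eventually_elim
    case (elim x)
    then show ?case
      by (subst scaled_log_deriv_eq_ratio_sum[of "b x" "\<epsilon> x" n "r x"]) (auto simp: mult.commute)
  qed
  from Lim_transform_eventually[OF lim this] show ?case
    by (simp add: U[of n])
qed

text \<open>
  In the equation for the coefficient of order \<open>n\<close>, the factor of the \<open>n\<close>-th difference is the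
  constant coefficient of an iterate, and it tends to \<open>U\<^sub>0^n = 1\<close>; so the differences can be solved
  for one after the other. The same constant coefficient equals \<open>b\<^sub>n\<close>, which therefore is
  eventually nonzero, and the ratios are meaningful.
\<close>

lemma symbol_from_log_deriv_limit:
  assumes bot: "F \<noteq> bot" and \<epsilon>: "(\<epsilon> \<longlongrightarrow> 0) F" "\<forall>\<^sub>F x in F. \<epsilon> x \<noteq> 0"
    and b0: "\<forall>\<^sub>F x in F. b x 0 = 1"
    and \<Psi>: "\<And>n. ((\<lambda>x. scaled_log_deriv (\<epsilon> x) (b x) $ n) \<longlongrightarrow> U $ n) F" and U0: "U $ 0 = 1"
  obtains W where "has_symbol F \<epsilon> (\<lambda>x i. b x (Suc i) / b x i) W"
    "\<And>n. U $ n = (\<Sum>k\<le>n. W $ k * (U ^ k) $ (n - k))"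
proof -
  let ?\<Psi> = "\<lambda>x. scaled_log_deriv (\<epsilon> x) (b x)"
  define r where "r x i = b x (Suc i) / b x i" for x i
  define w where "w k x = fdiff k (r x) 0 / (fact k * \<epsilon> x ^ k)" for k x
  have P: "((\<lambda>x. riccati_iterate (\<epsilon> x) (?\<Psi> x) k $ j) \<longlongrightarrow> (U ^ k) $ j) F" for k j
    by (intro riccati_iterate_tendsto \<epsilon> \<Psi>)
  have U0k: "(U ^ k) $ 0 = 1" for k
    using U0 by (simp add: fps_power_zeroth)
  have b1: "((\<lambda>x. b x i) \<longlongrightarrow> 1) F" for i
  proof (rule Lim_transform_eventually)
    show "((\<lambda>x. riccati_iterate (\<epsilon> x) (?\<Psi> x) i $ 0) \<longlongrightarrow> 1) F"
      using P[of i 0] by (simp add: U0k)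
    show "\<forall>\<^sub>F x in F. riccati_iterate (\<epsilon> x) (?\<Psi> x) i $ 0 = b x i"
      using \<epsilon>(2) b0 by eventually_elim (simp add: riccati_iterate_nth_0)
  qed
  have nz: "\<forall>\<^sub>F x in F. b x i \<noteq> 0" for i
    by (rule tendsto_imp_eventually_ne[OF b1]) simp
  have rec: "\<forall>\<^sub>F x in F. ?\<Psi> x $ n = (\<Sum>k\<le>n. w k x * riccati_iterate (\<epsilon> x) (?\<Psi> x) k $ (n - k))" for n
  proof -
    have "\<forall>\<^sub>F x in F. \<forall>i\<in>{..n}. b x i \<noteq> 0"
      by (intro eventually_ball_finite ballI nz) auto
    then show ?thesis
      using \<epsilon>(2) b0
    proof eventually_elim
      case (elim x)
      then show ?case
        unfolding w_def by (intro scaled_log_deriv_eq_ratio_sum) (auto simp: r_def)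
    qed
  qed
  have "\<exists>L. (w n \<longlongrightarrow> L) F" for n
  proof (induction n rule: less_induct)
    case (less n)
    define L where "L k = (SOME L. (w k \<longlongrightarrow> L) F)" for k
    have L: "(w k \<longlongrightarrow> L k) F" if "k < n" for k
      using someI_ex[OF less[OF that]] by (simp add: L_def)
    let ?P = "\<lambda>k x. riccati_iterate (\<epsilon> x) (?\<Psi> x) k"
    have "((\<lambda>x. (?\<Psi> x $ n - (\<Sum>k<n. w k x * ?P k x $ (n - k))) / ?P n x $ 0) \<longlongrightarrow>
        (U $ n - (\<Sum>k<n. L k * (U ^ k) $ (n - k))) / (U ^ n) $ 0) F"
      by (intro tendsto_intros \<Psi> L P) (auto simp: U0k)
    moreover have "\<forall>\<^sub>F x in F. ?P n x $ 0 \<noteq> 0"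
      using P[of n 0] by (rule tendsto_imp_eventually_ne) (simp add: U0k)
    then have "\<forall>\<^sub>F x in F. (?\<Psi> x $ n - (\<Sum>k<n. w k x * ?P k x $ (n - k))) / ?P n x $ 0 = w n x"
      using rec[of n]
    proof eventually_elim
      case (elim x)
      have "?\<Psi> x $ n = (\<Sum>k<n. w k x * ?P k x $ (n - k)) + w n x * ?P n x $ 0"
        using elim(2) by (simp add: lessThan_Suc_atMost[symmetric])
      then show ?case using elim(1) by simp
    qed
    ultimately show ?case using Lim_transform_eventually by blast
  qed
  then obtain V where V: "\<And>n. (w n \<longlongrightarrow> V n) F" by metis
  define W where "W = Abs_fps V"
  have "has_symbol F \<epsilon> r W"
  proof (rule has_symbol_at_0I[OF \<epsilon>])
    fix k
    have "((\<lambda>x. fact k * w k x) \<longlongrightarrow> fact k * W $ k) F"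
      unfolding W_def fps_nth_Abs_fps by (intro tendsto_intros V)
    then show "((\<lambda>x. fdiff k (r x) 0 / \<epsilon> x ^ k) \<longlongrightarrow> fact k * W $ k) F"
      by (simp add: w_def)
  qed
  moreover have "U $ n = (\<Sum>k\<le>n. W $ k * (U ^ k) $ (n - k))" for n
  proof (rule tendsto_unique[OF bot])
    show "((\<lambda>x. \<Sum>k\<le>n. w k x * riccati_iterate (\<epsilon> x) (?\<Psi> x) k $ (n - k)) \<longlongrightarrow> U $ n) F"
      by (rule Lim_transform_eventually[OF \<Psi> rec])
    show "((\<lambda>x. \<Sum>k\<le>n. w k x * riccati_iterate (\<epsilon> x) (?\<Psi> x) k $ (n - k)) \<longlongrightarrow> (\<Sum>k\<le>n. W $ k * (U ^ k) $ (n - k))) F"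
      unfolding W_def fps_nth_Abs_fps by (intro tendsto_intros V P)
  qed
  ultimately show ?thesis
    using that by (simp add: r_def[abs_def])
qed

section \<open>The tree series\<close>

text \<open>
  If \<open>T = z exp T\<close>, this is \<open>exp(r T) / (1 - T)\<close>, and the series \<open>abel_series\<close> below is
  \<open>exp(r T)\<close>. The latter is defined through the former to avoid the exponent \<open>n - 1\<close> in
  \<open>r (r + n)^(n-1) / n!\<close>.
\<close>

definition abel_aux :: "real \<Rightarrow> real fps" where
  "abel_aux r = Abs_fps (\<lambda>n. (r + real n) ^ n / fact n)"

definition abel_series :: "real \<Rightarrow> real fps" where
  "abel_series r = abel_aux r - fps_X * abel_aux (r + 1)"

lemma abel_series_nth_0 [simp]: "abel_series r $ 0 = 1"
  by (simp add: abel_series_def abel_aux_def)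

lemma power_over_fact_diff:
  "x ^ Suc n / fact (Suc n) - x ^ n / fact n = (x - real (Suc n)) * x ^ n / fact (Suc n)"
  by (simp add: field_simps del: of_nat_Suc)

lemma abel_series_nth_Suc: "abel_series r $ Suc n = r * (r + real (Suc n)) ^ n / fact (Suc n)"
  using power_over_fact_diff[of "r + real (Suc n)" n]
  by (simp add: abel_series_def abel_aux_def add_ac del: fact_Suc)

lemma fps_deriv_abel_series: "fps_deriv (abel_series r) = fps_const r * abel_aux (r + 1)"
  by (rule fps_ext) (simp add: abel_series_nth_Suc abel_aux_def add_ac del: of_nat_Suc,
    simp add: add_ac)

text \<open>
  Abel's binomial identities, proved together: the derivative of the first is a combination of
  instances of the second, so the first at order \<open>n + 1\<close> follows from the second at order \<open>n\<close>, and
  then the definition of \<open>abel_series\<close> gives the second at order \<open>n + 1\<close>.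
\<close>

lemma abel_convolution:
  "abel_series r * abel_series s = abel_series (r + s)" (is ?A)
  "abel_series r * abel_aux s = abel_aux (r + s)" (is ?B)
proof -
  have "(\<forall>r s. (abel_series r * abel_series s) $ n = abel_series (r + s) $ n) \<and>
        (\<forall>r s. (abel_series r * abel_aux s) $ n = abel_aux (r + s) $ n)" for n
  proof (induction n)
    case 0
    then show ?case by (simp add: abel_aux_def)
  next
    case (Suc n)
    have E: "(abel_series r * abel_series s) $ Suc n = abel_series (r + s) $ Suc n" for r s
    proof -
      have IH: "(abel_series r * abel_aux (s + 1)) $ n = abel_aux (r + s + 1) $ n"
        "(abel_series s * abel_aux (r + 1)) $ n = abel_aux (r + s + 1) $ n"
        using Suc.IH by (simp_all add: add_ac)
      have "real (Suc n) * (abel_series r * abel_series s) $ Suc n = fps_deriv (abel_series r * abel_series s) $ n"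
        by (simp only: fps_deriv_nth Suc_eq_plus1)
      also have "fps_deriv (abel_series r * abel_series s) =
          fps_const s * (abel_series r * abel_aux (s + 1)) + fps_const r * (abel_series s * abel_aux (r + 1))"
        unfolding fps_deriv_mult fps_deriv_abel_series by (simp add: mult_ac)
      also have "\<dots> $ n = (r + s) * abel_aux (r + s + 1) $ n"
        unfolding fps_add_nth fps_mult_left_const_nth IH by (simp add: distrib_right)
      also have "\<dots> = fps_deriv (abel_series (r + s)) $ n"
        unfolding fps_deriv_abel_series by simp
      also have "\<dots> = real (Suc n) * abel_series (r + s) $ Suc n"
        by simp
      finally show ?thesis by simp
    qed
    have aux: "abel_aux s = abel_series s + fps_X * abel_aux (s + 1)" for s
      by (simp add: abel_series_def)
    have "(abel_series r * abel_aux s) $ Suc n = abel_aux (r + s) $ Suc n" for r s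
    proof -
      have "abel_series r * abel_aux s = abel_series r * abel_series s + fps_X * (abel_series r * abel_aux (s + 1))"
        by (subst aux) (simp add: algebra_simps)
      then have "(abel_series r * abel_aux s) $ Suc n = abel_series (r + s) $ Suc n + abel_aux (r + s + 1) $ n"
        using E Suc.IH by (simp add: add.assoc)
      also have "\<dots> = abel_aux (r + s) $ Suc n"
        by (subst aux) simp
      finally show ?thesis .
    qed
    with E show ?case by blast
  qed
  then show ?A ?B by (auto intro: fps_ext)
qed

lemma abel_series_0: "abel_series 0 = 1"
proof (rule fps_ext)
  fix n show "abel_series 0 $ n = 1 $ n" by (cases n) (auto simp: abel_series_nth_Suc)
qed

lemma abel_series_power: "abel_series r ^ k = abel_series (real k * r)"
  by (induction k) (simp_all add: abel_series_0 abel_convolution algebra_simps)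

text \<open>
  The powers of the series are known in closed form, so that the equation
  \<open>U = exp(z U)\<close> reduces to two instances of the binomial theorem.
\<close>

lemma abel_series_exp_equation:
  "abel_series 1 $ n = (\<Sum>k\<le>n. (abel_series 1 ^ k) $ (n - k) / fact k)"
proof -
  have aux_sum: "(\<Sum>k\<le>n. abel_aux (real k + c) $ (n - k) / fact k) = (1 + real n + c) ^ n / fact n" for n c
  proof -
    have "(\<Sum>k\<le>n. abel_aux (real k + c) $ (n - k) / fact k) =
        (\<Sum>k\<le>n. real (n choose k) * 1 ^ k * (real n + c) ^ (n - k) / fact n)"
      by (intro sum.cong) (auto simp: abel_aux_def binomial_fact of_nat_diff add_ac)
    also have "\<dots> = (1 + (real n + c)) ^ n / fact n"
      by (subst binomial_ring) (simp add: sum_divide_distrib)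
    finally show ?thesis by (simp add: add_ac)
  qed
  show ?thesis
  proof (cases n)
    case 0
    then show ?thesis by simp
  next
    case (Suc m)
    have "(\<Sum>k\<le>n. (abel_series 1 ^ k) $ (n - k) / fact k) =
        (\<Sum>k\<le>n. abel_aux (real k + 0) $ (n - k) / fact k) - 
        (\<Sum>k\<le>n. (fps_X * abel_aux (real k + 1)) $ (n - k) / fact k)"
      unfolding abel_series_power unfolding abel_series_def
      by (simp add: sum_subtractf[symmetric] diff_divide_distrib)
    also have "(\<Sum>k\<le>n. (fps_X * abel_aux (real k + 1)) $ (n - k) / fact k) =
        (\<Sum>k\<le>m. abel_aux (real k + 1) $ (m - k) / fact k)"
      unfolding Suc by (auto simp: Suc_diff_le intro!: sum.cong)
    also have "(\<Sum>k\<le>n. abel_aux (real k + 0) $ (n - k) / fact k) - \<dots> = 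
        (1 + real n) ^ n / fact n - (1 + real n) ^ m / fact m"
      unfolding aux_sum using Suc by (simp add: add_ac)
    also have "\<dots> = abel_series 1 $ n"
      using power_over_fact_diff[of "1 + real n" m] unfolding Suc abel_series_nth_Suc
      by (simp del: fact_Suc power_Suc)
    finally show ?thesis ..
  qed
qed

text \<open>
  In closed form the equation says \<open>U = exp(\<sigma> z U)\<close>; the parameter \<open>\<sigma>\<close> only rescales the variable
  of \<open>abel_series 1\<close>.
\<close>

lemma tree_series_exp_equation:
  fixes \<sigma> :: real
  defines "U \<equiv> Abs_fps (\<lambda>n. (\<sigma> * real (Suc n)) ^ n / fact (Suc n))"
  shows "U $ n = (\<Sum>k\<le>n. fps_exp \<sigma> $ k * (U ^ k) $ (n - k))"
proof -
  have U: "U = abel_series 1 oo (fps_const \<sigma> * fps_X)"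
  proof (rule fps_ext)
    fix n
    show "U $ n = (abel_series 1 oo (fps_const \<sigma> * fps_X)) $ n"
      by (cases n) (auto simp: U_def abel_series_nth_Suc power_mult_distrib add_ac)
  qed
  have "(U ^ k) $ j = \<sigma> ^ j * (abel_series 1 ^ k) $ j" for k j
    unfolding U by (subst fps_compose_power) simp_all
  then have "(\<Sum>k\<le>n. fps_exp \<sigma> $ k * (U ^ k) $ (n - k)) =
      (\<Sum>k\<le>n. \<sigma> ^ n * ((abel_series 1 ^ k) $ (n - k) / fact k))"
    by (intro sum.cong) (auto simp: power_add[symmetric])
  also have "\<dots> = U $ n"
    unfolding sum_distrib_left[symmetric] abel_series_exp_equation[symmetric] by (simp add: U)
  finally show ?thesis ..
qed

section \<open>Moments of the roots\<close>

lemma map_poly_complex_mult: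
  "map_poly complex_of_real (p * q) = map_poly complex_of_real p * map_poly complex_of_real q"
  by (rule poly_eqI) (simp add: coeff_map_poly coeff_mult)

lemma monic_real_rooted_splits:
  assumes "lead_coeff p = 1"
    and "\<And>z. poly (map_poly complex_of_real p) z = 0 \<Longrightarrow> z \<in> \<real>"
  shows "p = (\<Prod>x\<in>#proots p. [:-x, 1:]) \<and> size (proots p) = degree p"
  using assms
proof (induction "degree p" arbitrary: p)
  case 0
  then have "p = 1" by (metis monom_0 monom_eq_1 poly_eqI degree_0_id coeff_pCons_0 degree_eq_zeroE one_pCons)
  then show ?case by simp
next
  case (Suc n)
  have deg: "degree (map_poly complex_of_real p) = degree p"
    by (simp add: degree_map_poly)
  then have "\<not> constant (poly (map_poly complex_of_real p))"
    using Suc.hyps(2) by (simp add: constant_degree)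
  then obtain z where z: "poly (map_poly complex_of_real p) z = 0"
    using fundamental_theorem_of_algebra by blast
  then obtain x where x: "z = complex_of_real x"
    using Suc.prems(2) by (auto elim: Reals_cases)
  have ev: "poly (map_poly complex_of_real q) (complex_of_real x) = complex_of_real (poly q x)" for q
    by (induction q) (auto simp: map_poly_pCons)
  have "poly p x = 0"
    using z unfolding x ev by simp
  then obtain q where q: "p = [:-x, 1:] * q"
    by (auto simp: poly_eq_0_iff_dvd elim: dvdE)
  have q0: "q \<noteq> 0" using Suc.hyps(2) q by auto
  have deg_q: "degree q = n"
    using Suc.hyps(2) q0 unfolding q by (subst (asm) degree_mult_eq) auto
  have "lead_coeff q = 1"
    using Suc.prems(1) unfolding q lead_coeff_mult by simp
  moreover have "z \<in> \<real>" if "poly (map_poly complex_of_real q) z = 0" for z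
    using that Suc.prems(2)[of z] unfolding q map_poly_complex_mult by simp
  ultimately have IH: "q = (\<Prod>x\<in>#proots q. [:-x, 1:]) \<and> size (proots q) = degree q"
    using Suc.hyps(1)[of q] deg_q by simp
  have "proots p = proots [:-x, 1:] + proots q"
    unfolding q using q0 by (subst proots_mult) auto
  then have "proots p = add_mset x (proots q)" by simp
  then show ?case
    using IH q deg_q Suc.hyps(2) by simp
qed

text \<open>
  The reflected polynomial is \<open>\<Prod> (1 - x z)\<close>, and each factor contributes the geometric series
  \<open>x / (1 - x z)\<close>.
\<close>

lemma log_deriv_reflect_prod:
  fixes M :: "real multiset"
  defines "Q \<equiv> fps_of_poly (reflect_poly (\<Prod>x\<in>#M. [:-x, 1:]))"
  shows "(- fps_deriv Q * inverse Q) $ n = (\<Sum>x\<in>#M. x ^ Suc n)"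
  unfolding Q_def
proof (induction M)
  case empty
  then show ?case by simp
next
  case (add x M)
  define L where "L = fps_of_poly (reflect_poly [:-x, 1:])"
  define Q where "Q = fps_of_poly (reflect_poly (\<Prod>x\<in>#M. [:-x, 1:]))"
  have L: "L = 1 - fps_const x * fps_X"
    by (rule fps_ext) (auto simp: L_def coeff_reflect_poly coeff_pCons fps_X_def split: nat.splits)
  have L0: "L $ 0 \<noteq> 0" by (simp add: L)
  have "lead_coeff (\<Prod>x\<in>#M. [:-x, 1:]) = 1"
    by (induction M) (simp_all add: lead_coeff_mult del: mult_pCons_left)
  then have Q0: "Q $ 0 \<noteq> 0" by (simp add: Q_def)
  have "inverse L = Abs_fps (\<lambda>n. x ^ n)"
  proof (rule fps_inverse_unique, rule fps_ext)
    fix n show "(L * Abs_fps (\<lambda>n. x ^ n)) $ n = 1 $ n"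
      by (cases n) (auto simp: L left_diff_distrib mult.assoc)
  qed
  then have lin: "(- fps_deriv L * inverse L) $ n = x ^ Suc n"
    by (simp add: L)
  have "- fps_deriv (L * Q) * inverse (L * Q) =
      (- fps_deriv L * inverse L) * (Q * inverse Q) + (- fps_deriv Q * inverse Q) * (L * inverse L)"
    by (simp add: fps_inverse_mult algebra_simps)
  also have "L * inverse L = 1" using inverse_mult_eq_1'[OF L0] .
  also have "Q * inverse Q = 1" using inverse_mult_eq_1'[OF Q0] .
  finally have "(- fps_deriv (L * Q) * inverse (L * Q)) $ n = x ^ Suc n + (- fps_deriv Q * inverse Q) $ n"
    using lin by simp
  moreover have "fps_of_poly (reflect_poly (\<Prod>x\<in>#add_mset x M. [:-x, 1:])) = L * Q"
    by (simp add: L_def Q_def reflect_poly_mult fps_of_poly_mult del: mult_pCons_left)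
  ultimately show ?case using add.IH by (simp add: Q_def)
qed

lemma sum_mset_count: "(\<Sum>x\<in>#M. f x) = (\<Sum>x\<in>set_mset M. real (count M x) * f x)"
proof (induction M)
  case (add y M)
  have "(\<Sum>x\<in>set_mset (add_mset y M). real (count (add_mset y M) x) * f x) =
      (\<Sum>x\<in>insert y (set_mset M). (if x = y then f x else 0) + real (count M x) * f x)"
    by (intro sum.cong) (auto simp: algebra_simps)
  also have "\<dots> = f y + (\<Sum>x\<in>insert y (set_mset M). real (count M x) * f x)"
    by (simp add: sum.distrib)
  also have "(\<Sum>x\<in>insert y (set_mset M). real (count M x) * f x) = (\<Sum>x\<in>set_mset M. real (count M x) * f x)"
    by (intro sum.mono_neutral_right) (auto simp: not_in_iff)
  finally show ?case using add.IH by simp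
qed simp

lemma moment_root_distribution:
  assumes "proots p \<noteq> {#}"
  shows "moment (root_distribution p) k = (\<Sum>x\<in>#proots p. x ^ k) / real (size (proots p))"
proof -
  have "moment (root_distribution p) k = (\<integral>x. x ^ k \<partial>measure_pmf (pmf_of_multiset (proots p)))"
    unfolding moment_def root_distribution_def by (subst integral_distr) auto
  also have "\<dots> = (\<Sum>x\<in>set_mset (proots p). x ^ k * pmf (pmf_of_multiset (proots p)) x)"
    using assms by (intro integral_measure_pmf_real) auto
  finally show ?thesis
    using assms by (simp add: sum_mset_count sum_divide_distrib mult.commute)
qed

text \<open>
  The product is the falling factorial \<open>d (d - 1) \<dots> (d - i + 1)\<close> divided by \<open>d^i\<close>. This weight
  cancels the binomial coefficient in \<open>norm_coeff\<close> and the factorial in the generating function,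
  which becomes the reflected polynomial.
\<close>

lemma scaled_log_deriv_moments:
  assumes d: "d \<ge> 1" and p: "degree p = d" "lead_coeff p = 1"
    and real: "\<And>z. poly (map_poly complex_of_real p) z = 0 \<Longrightarrow> z \<in> \<real>"
  shows "scaled_log_deriv (- 1 / real d) (\<lambda>i. norm_coeff d p i * (\<Prod>l<i. 1 - real l / real d)) $ n =
    moment (root_distribution p) (Suc n)"
proof -
  let ?b = "\<lambda>i. norm_coeff d p i * (\<Prod>l<i. 1 - real l / real d)"
  let ?Q = "fps_of_poly (reflect_poly p)"
  have splits: "p = (\<Prod>x\<in>#proots p. [:-x, 1:])" "size (proots p) = d"
    using monic_real_rooted_splits[of p] p real by auto
  have "scaled_egf (- 1 / real d) ?b $ i = ?Q $ i" for i
  proof (cases "i \<le> d")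
    case True
    have E: "(- 1 / real d) ^ i = (-1) ^ i / real d ^ i"
      by (rule power_divide)
    have "d > 0" using d by simp
    note P = prod_one_minus_over[OF this, of i]
    show ?thesis
      unfolding scaled_egf_def fps_nth_Abs_fps norm_coeff_def P E
      using True d p(1) by (simp add: coeff_reflect_poly field_simps power_mult_distrib[symmetric])
  next
    case False
    then show ?thesis
      using p(1) by (simp add: scaled_egf_def norm_coeff_def coeff_reflect_poly)
  qed
  then have "scaled_egf (- 1 / real d) ?b = ?Q"
    by (intro fps_ext)
  then have "scaled_log_deriv (- 1 / real d) ?b $ n = (fps_const (1 / real d) * (- fps_deriv ?Q * inverse ?Q)) $ n"
    unfolding scaled_log_deriv_def
    by (simp add: mult.assoc fps_const_neg[symmetric] del: fps_const_neg)
  also have "\<dots> = (\<Sum>x\<in>#proots p. x ^ Suc n) / real d"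
    unfolding fps_mult_left_const_nth
    using log_deriv_reflect_prod[of "proots p" n, folded splits(1)] by (simp del: power_Suc)
  also have "\<dots> = moment (root_distribution p) (Suc n)"
    using splits(2) d by (subst moment_root_distribution) auto
  finally show ?thesis .
qed

section \<open>The limit theorem\<close>

text \<open>
  For the weighted coefficients, the limiting logarithmic derivative is
  \<open>U(z) = \<Sum> M\<^sub>n\<^sub>+\<^sub>1 z^n\<close>, and comparing coefficients in \<open>U = W(z U)\<close> shows that their ratios have
  a symbol \<open>W = 1 + M\<^sub>2 s + \<dots>\<close>. Removing the weights divides the ratio at \<open>i\<close> by
  \<open>1 - i/d\<close>, hence the symbol by \<open>1 + s\<close>.
\<close>

lemma symbol_coefficient_ratio:
  fixes p :: "nat \<Rightarrow> real poly" and d :: "nat \<Rightarrow> nat"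
  assumes monic: "\<And>d. d \<ge> 1 \<Longrightarrow> degree (p d) = d \<and> lead_coeff (p d) = 1"
    and real: "\<And>d z. d \<ge> 1 \<Longrightarrow> poly (map_poly complex_of_real (p d)) z = 0 \<Longrightarrow> z \<in> \<real>"
    and mean: "\<And>d. d \<ge> 1 \<Longrightarrow> norm_coeff d (p d) 1 = 1"
    and moments: "\<And>k. (\<lambda>d. moment (root_distribution (p d)) k) \<longlonglongrightarrow> M k"
    and d: "filterlim d at_top sequentially"
  obtains A where
    "has_symbol sequentially (\<lambda>j. - 1 / real (d j))
       (\<lambda>j i. norm_coeff (d j) (p (d j)) (Suc i) / norm_coeff (d j) (p (d j)) i) A"
    "A $ 0 = 1" "A $ 1 = M 2 - M 1 ^ 2"
proof -
  define \<epsilon> where "\<epsilon> j = - 1 / real (d j)" for j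
  define a where "a j i = norm_coeff (d j) (p (d j)) i" for j i
  define N where "N j i = a j i * (\<Prod>l<i. 1 - real l / real (d j))" for j i
  define U where "U = Abs_fps (\<lambda>n. M (Suc n))"
  have dgt: "\<forall>\<^sub>F j in sequentially. d j > i" for i
    using eventually_compose_filterlim[OF eventually_gt_at_top d] .
  have \<epsilon>0: "\<epsilon> \<longlonglongrightarrow> 0"
    unfolding \<epsilon>_def using filterlim_compose[OF lim_const_over_n[of "-1 :: real"] d] by simp
  have \<epsilon>nz: "\<forall>\<^sub>F j in sequentially. \<epsilon> j \<noteq> 0"
    using dgt[of 0] by eventually_elim (simp add: \<epsilon>_def)
  have a0: "\<forall>\<^sub>F j in sequentially. a j 0 = 1"
    using dgt[of 0]
  proof eventually_elim
    case (elim j)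
    then show ?case using monic[of "d j"] by (auto simp: a_def intro: norm_coeff_0)
  qed
  then have N0: "\<forall>\<^sub>F j in sequentially. N j 0 = 1"
    by (simp add: N_def)
  have \<Psi>: "\<forall>\<^sub>F j in sequentially. scaled_log_deriv (\<epsilon> j) (N j) $ n = moment (root_distribution (p (d j))) (Suc n)" for n
    using dgt[of 0]
  proof eventually_elim
    case (elim j)
    then have "d j \<ge> 1" by simp
    then show ?case
      unfolding \<epsilon>_def N_def a_def using monic[of "d j"] real[of "d j"]
      by (intro scaled_log_deriv_moments) auto
  qed
  have lim: "(\<lambda>j. scaled_log_deriv (\<epsilon> j) (N j) $ n) \<longlonglongrightarrow> U $ n" for n
  proof (rule Lim_transform_eventually)
    show "(\<lambda>j. moment (root_distribution (p (d j))) (Suc n)) \<longlonglongrightarrow> U $ n"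
      unfolding U_def fps_nth_Abs_fps by (rule filterlim_compose[OF moments d])
    show "\<forall>\<^sub>F j in sequentially. moment (root_distribution (p (d j))) (Suc n) = scaled_log_deriv (\<epsilon> j) (N j) $ n"
      using \<Psi>[of n] by eventually_elim simp
  qed
  have U0: "U $ 0 = 1"
  proof -
    have "\<forall>\<^sub>F j in sequentially. scaled_log_deriv (\<epsilon> j) (N j) $ 0 = 1"
      using N0 \<epsilon>nz dgt[of 0]
    proof eventually_elim
      case (elim j)
      then show ?case
        using riccati_iterate_nth_0[of "N j" "\<epsilon> j" 1] mean[of "d j"] by (simp add: N_def a_def)
    qed
    then have "(\<lambda>j. scaled_log_deriv (\<epsilon> j) (N j) $ 0) \<longlonglongrightarrow> 1"
      by (rule tendsto_eventually)
    then show ?thesis using lim[of 0] LIMSEQ_unique by blast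
  qed
  obtain W where W: "has_symbol sequentially \<epsilon> (\<lambda>j i. N j (Suc i) / N j i) W"
      and UW: "\<And>n. U $ n = (\<Sum>k\<le>n. W $ k * (U ^ k) $ (n - k))"
    using symbol_from_log_deriv_limit[OF sequentially_bot \<epsilon>0 \<epsilon>nz N0 lim U0] by blast
  have W0: "W $ 0 = 1" using UW[of 0] U0 by simp
  have "U $ 1 = W $ 1" using UW[of 1] U0 by simp
  moreover have "U $ 1 = M 2" unfolding U_def fps_nth_Abs_fps Suc_1 ..
  ultimately have W1: "W $ 1 = M 2" by simp
  have M1: "M 1 = 1" using U0 by (simp add: U_def)
  define A where "A = W * Abs_fps (\<lambda>k. (-1) ^ k)"
  have "has_symbol sequentially \<epsilon> (\<lambda>j i. a j (Suc i) / a j i) A"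
  proof (rule has_symbol_cong)
    show "has_symbol sequentially \<epsilon> (\<lambda>j i. N j (Suc i) / N j i * (1 / (1 + \<epsilon> j * real i))) A"
      unfolding A_def by (intro has_symbol_mult W has_symbol_reciprocal \<epsilon>0 \<epsilon>nz)
    fix i
    show "\<forall>\<^sub>F j in sequentially. N j (Suc i) / N j i * (1 / (1 + \<epsilon> j * real i)) = a j (Suc i) / a j i"
      using dgt[of i]
    proof eventually_elim
      case (elim j)
      have nz: "1 - real l / real (d j) \<noteq> 0" if "l \<le> i" for l
        using that elim by (simp add: field_simps)
      then have P: "(\<Prod>l<i. 1 - real l / real (d j)) \<noteq> 0" using elim by auto
      have "1 + \<epsilon> j * real i = 1 - real i / real (d j)" by (simp add: \<epsilon>_def)
      then show ?case using P nz[of i] elim by (simp add: N_def)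
    qed
  qed
  moreover have "A $ 0 = 1" by (simp add: A_def W0)
  moreover have "A $ 1 = M 2 - M 1 ^ 2" by (simp add: A_def fps_mult_nth_1 W0 W1[simplified] M1[simplified])
  ultimately show ?thesis using that by (simp add: \<epsilon>_def[abs_def] a_def[abs_def])
qed

text \<open>
  On the scale \<open>\<epsilon> = -1/d\<close> the coefficient ratios have a symbol \<open>1 + \<sigma> s + \<dots>\<close>, so their \<open>m\<close>-th
  powers have the symbol \<open>exp(\<sigma> s)\<close> on the scale \<open>-m/d\<close>, and the limit is a coefficient of the
  tree series.
\<close>

lemma finite_free_cumulant_limit:
  fixes p :: "nat \<Rightarrow> real poly" and d m :: "nat \<Rightarrow> nat"
  assumes monic: "\<And>d. d \<ge> 1 \<Longrightarrow> degree (p d) = d \<and> lead_coeff (p d) = 1"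
    and real: "\<And>d z. d \<ge> 1 \<Longrightarrow> poly (map_poly complex_of_real (p d)) z = 0 \<Longrightarrow> z \<in> \<real>"
    and mean: "\<And>d. d \<ge> 1 \<Longrightarrow> finite_free_cumulant d 1 (p d) = 1"
    and moments: "\<And>k. (\<lambda>d. moment (root_distribution (p d)) k) \<longlonglongrightarrow> M k"
    and d: "filterlim d at_top sequentially" and m: "filterlim m at_top sequentially"
    and md: "(\<lambda>j. real (m j) / real (d j)) \<longlonglongrightarrow> 0"
  shows "(\<lambda>j. finite_free_cumulant (d j) (Suc n) (dilation (d j) (1 / real (m j))
      (fadd_power (d j) (m j) (fmult_power (d j) (m j) (p (d j))))))
    \<longlonglongrightarrow> ((M 2 - M 1 ^ 2) * real (Suc n)) ^ n / fact (Suc n)"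
proof -
  define \<epsilon> where "\<epsilon> j = - 1 / real (d j)" for j
  define a where "a j i = norm_coeff (d j) (p (d j)) i" for j i
  define r where "r j i = a j (Suc i) / a j i" for j i
  define \<sigma> where "\<sigma> = M 2 - M 1 ^ 2"
  define U where "U = Abs_fps (\<lambda>n. (\<sigma> * real (Suc n)) ^ n / fact (Suc n))"
  have a0: "norm_coeff d (p d) 0 = 1" if "d \<ge> 1" for d
    using monic[OF that] by (intro norm_coeff_0) auto
  have a1: "norm_coeff d (p d) 1 = 1" if "d \<ge> 1" for d
    using mean[OF that] finite_free_cumulant_1[OF a0[OF that]] by simp
  obtain A where A: "has_symbol sequentially \<epsilon> r A" "A $ 0 = 1" "A $ 1 = \<sigma>"
  proof (rule symbol_coefficient_ratio[OF monic real a1 moments d])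
    fix A
    assume "has_symbol sequentially (\<lambda>j. - 1 / real (d j))
       (\<lambda>j i. norm_coeff (d j) (p (d j)) (Suc i) / norm_coeff (d j) (p (d j)) i) A"
      "A $ 0 = 1" "A $ 1 = M 2 - M 1 ^ 2"
    then show ?thesis
      using that[of A] by (simp add: \<epsilon>_def[abs_def] r_def[abs_def] a_def[abs_def] \<sigma>_def)
  qed
  have dgt: "\<forall>\<^sub>F j in sequentially. d j > i" for i
    using eventually_compose_filterlim[OF eventually_gt_at_top d] .
  have mgt: "\<forall>\<^sub>F j in sequentially. m j > 0"
    using eventually_compose_filterlim[OF eventually_gt_at_top m] .
  have \<epsilon>0: "\<epsilon> \<longlonglongrightarrow> 0"
    unfolding \<epsilon>_def using filterlim_compose[OF lim_const_over_n[of "-1 :: real"] d] by simp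
  have \<epsilon>nz: "\<forall>\<^sub>F j in sequentially. \<epsilon> j \<noteq> 0"
    using dgt[of 0] by eventually_elim (simp add: \<epsilon>_def)
  have m\<epsilon>0: "(\<lambda>j. real (m j) * \<epsilon> j) \<longlonglongrightarrow> 0"
    using tendsto_minus[OF md] by (simp add: \<epsilon>_def)
  have m\<epsilon>nz: "\<forall>\<^sub>F j in sequentially. real (m j) * \<epsilon> j \<noteq> 0"
    using mgt \<epsilon>nz by eventually_elim simp
  have r0: "\<forall>\<^sub>F j in sequentially. r j 0 = 1"
    using dgt[of 0]
  proof eventually_elim
    case (elim j)
    then show ?case using a0[of "d j"] a1[of "d j"] by (simp add: r_def a_def)
  qed
  have anz: "\<forall>\<^sub>F j in sequentially. a j i \<noteq> 0" for i
  proof (induction i)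
    case 0
    show ?case
      using dgt[of 0]
    proof eventually_elim
      case (elim j)
      then show ?case using a0[of "d j"] by (simp add: a_def)
    qed
  next
    case (Suc i)
    have "(\<lambda>j. r j i) \<longlonglongrightarrow> 1" using has_symbolD[OF A(1), of 0 i] A(2) by simp
    then have "\<forall>\<^sub>F j in sequentially. r j i \<noteq> 0" by (rule tendsto_imp_eventually_ne) simp
    then show ?case by eventually_elim (simp add: r_def)
  qed
  have "(\<lambda>j. scaled_log_deriv (real (m j) * \<epsilon> j) (\<lambda>i. a j i ^ m j) $ n) \<longlonglongrightarrow> U $ n"
  proof (rule log_deriv_limit_from_symbol[OF m\<epsilon>0 m\<epsilon>nz])
    show "has_symbol sequentially (\<lambda>j. real (m j) * \<epsilon> j) (\<lambda>j i. r j i ^ m j) (fps_exp \<sigma>)"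
      using has_symbol_large_power[OF sequentially_bot \<epsilon>0 \<epsilon>nz m m\<epsilon>0 A(1) r0] A(3) by simp
    show "U $ n = (\<Sum>k\<le>n. fps_exp \<sigma> $ k * (U ^ k) $ (n - k))" for n
      unfolding U_def by (rule tree_series_exp_equation)
    show "\<forall>\<^sub>F j in sequentially. a j 0 ^ m j = 1"
      using dgt[of 0]
    proof eventually_elim
      case (elim j)
      then show ?case using a0[of "d j"] by (simp add: a_def)
    qed
    show "\<forall>\<^sub>F j in sequentially. a j (Suc i) ^ m j = r j i ^ m j * a j i ^ m j" for i
      using anz[of i] by eventually_elim (simp add: r_def power_divide)
  qed
  moreover have "\<forall>\<^sub>F j in sequentially. scaled_log_deriv (real (m j) * \<epsilon> j) (\<lambda>i. a j i ^ m j) $ n =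
      finite_free_cumulant (d j) (Suc n) (dilation (d j) (1 / real (m j))
        (fadd_power (d j) (m j) (fmult_power (d j) (m j) (p (d j)))))"
    using dgt[of "Suc n"] mgt
  proof eventually_elim
    case (elim j)
    then show ?case
      using finite_free_cumulant_convolution_powers[of "d j" "p (d j)" "m j" n] a0[of "d j"]
      by (simp add: \<epsilon>_def a_def)
  qed
  ultimately have "(\<lambda>j. finite_free_cumulant (d j) (Suc n) (dilation (d j) (1 / real (m j))
        (fadd_power (d j) (m j) (fmult_power (d j) (m j) (p (d j)))))) \<longlonglongrightarrow> U $ n"
    by (rule Lim_transform_eventually)
  then show ?thesis by (simp add: U_def \<sigma>_def)
qed

theorem theorem1p2:
  fixes p :: "nat \<Rightarrow> real poly" and \<mu> :: "real measure" and n :: nat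
  assumes monic: "\<And>d. d \<ge> 1 \<Longrightarrow> degree (p d) = d \<and> lead_coeff (p d) = 1"
    and nonneg_roots:
      "\<And>d z. d \<ge> 1 \<Longrightarrow> poly (map_poly complex_of_real (p d)) z = 0 \<Longrightarrow> z \<in> \<real>\<^sub>\<ge>\<^sub>0"
    and mean_one: "\<And>d. d \<ge> 1 \<Longrightarrow> finite_free_cumulant d 1 (p d) = 1"
    and prob: "real_distribution \<mu>"
    and compact_support: "compact (measure_support \<mu>)"
    and weak: "weak_conv_m (\<lambda>d. root_distribution (p d)) \<mu>"
    and moments: "\<And>k. (\<lambda>d. moment (root_distribution (p d)) k) \<longlonglongrightarrow> moment \<mu> k"
    and n: "n \<ge> 1"
  shows "(\<forall>d m :: nat \<Rightarrow> nat.
            filterlim d at_top sequentially \<longrightarrow> filterlim m at_top sequentially \<longrightarrow>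
            (\<lambda>j. real (m j) / real (d j)) \<longlonglongrightarrow> 0 \<longrightarrow>
            (\<lambda>j. finite_free_cumulant (d j) n
               (dilation (d j) (1 / real (m j))
                 (fadd_power (d j) (m j) (fmult_power (d j) (m j) (p (d j))))))
              \<longlonglongrightarrow> (free_cumulant \<mu> 2 * real n) ^ (n - 1) / fact n) \<and>
         (\<forall>\<eta>. is_eta (free_cumulant \<mu> 2) \<eta> \<longrightarrow>
            free_cumulant \<eta> n = (free_cumulant \<mu> 2 * real n) ^ (n - 1) / fact n)"
proof (intro conjI allI impI)
  fix d m :: "nat \<Rightarrow> nat"
  assume lims: "filterlim d at_top sequentially" "filterlim m at_top sequentially"
    "(\<lambda>j. real (m j) / real (d j)) \<longlonglongrightarrow> 0"
  have real: "z \<in> \<real>" if "d \<ge> 1" "poly (map_poly complex_of_real (p d)) z = 0" for d z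
    using nonneg_roots[OF that] nonneg_Reals_subset_Reals by blast
  obtain l where "n = Suc l" using n by (cases n) auto
  then show "(\<lambda>j. finite_free_cumulant (d j) n
      (dilation (d j) (1 / real (m j)) (fadd_power (d j) (m j) (fmult_power (d j) (m j) (p (d j))))))
    \<longlonglongrightarrow> (free_cumulant \<mu> 2 * real n) ^ (n - 1) / fact n"
    using finite_free_cumulant_limit[OF monic real mean_one moments lims, where n = l]
    by (simp add: free_cumulant_2)
next
  fix \<eta> assume "is_eta (free_cumulant \<mu> 2) \<eta>"
  then show "free_cumulant \<eta> n = (free_cumulant \<mu> 2 * real n) ^ (n - 1) / fact n"
    using n by (simp add: is_eta_def)
qed

end
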